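(* Let $p\ge 0$ be an integer and $z'>p-1$, $w'>-1$ real numbers. For every partition $\lambda=(\lambda_1\ge\lambda_2\ge\dots\ge\lambda_p\ge0)$ the multi-dimensional Jacobi polynomial $Jac^\lambda_{z'-p,w'}(x_1,\dots,x_p)$ is an eigenfunction of the Markov semigroup $M^t_{p,z',w'}$, $t>0$: $$M^t_{p,z',w'}\left(Jac^\lambda_{z'-p,w'}\right)=c(\lambda,t)\,Jac^\lambda_{z'-p,w'},$$ where $$c(\lambda,t)=\exp\left(t\sum_{i=1}^p\left(K_{p,z',w'}(p-i)-K_{p,z',w'}(\lambda_i+p-i)\right)\right).$$
   Context: Notation. $w_{p,z',w'}(x)=x^{w'}(1-x)^{z'-p}$ for $0<x<1$; the Jacobi polynomials on $(0,1)$ are $Jac^n_{\alpha,\beta}(x)=\frac{(\alpha+1)_n}{n!}\,{}_2F_1(-n,n+\alpha+\beta+1;\alpha+1;1-x)$, and $Jac^k_{z'-p,w'}$, $k\ge0$, are orthogonal with respect to $w_{p,z',w'}$; $$j^k_{p,z',w'}(x)=\frac{Jac^k_{z'-p,w'}(x)\sqrt{w_{p,z',w'}(x)}}{\sqrt{(Jac^k_{z'-p,w'},Jac^k_{z'-p,w'})}},$$ with $(\cdot,\cdot)$ the inner product of $L_2([0,1],w_{p,z',w'}(x)\,dx)$; $K_{p,z',w'}(i)=i(i+w'+z'+1-p)$ and $K_{p,z',w'}=\sum_{i=0}^{p-1}K_{p,z',w'}(i)$. Semigroup. $\mathcal W_p=\{(x_1,\dots,x_p)\in[0,1]^p:x_1\le\dots\le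 x_p\}$. $\mu_{p,z',w'}$ is the probability measure on $\mathcal W_p$ with Lebesgue density $\rho_{p,z',w'}(X)=B_{p,z',w'}\prod_{i<j}(x_i-x_j)^2\prod_{i=1}^pw_{p,z',w'}(x_i)$, $B_{p,z',w'}$ being the normalization constant. For $t>0$ put $$\mathcal P^t_{p,z',w'}(Y\mid X)=\frac{\sqrt{\rho_{p,z',w'}(Y)}}{\sqrt{\rho_{p,z',w'}(X)}}\,e^{tK_{p,z',w'}}\det\left[\sum_{k=0}^\infty e^{-tK_{p,z',w'}(k)}j^k_{p,z',w'}(x_i)j^k_{p,z',w'}(y_j)\right]_{i,j=1,\dots,p};$$ this is the transition density of a stationary Markov process on $\mathcal W_p$ with invariant distribution $\mu_{p,z',w'}$. The Markov semigroup on $L_2(\mathcal W_p,\mu_{p,z',w'})$ is $(M^t_{p,z',w'}f)(X)=\int_{\mathcal W_p}f(Y)\,\mathcal P^t_{p,z',w'}(Y\mid X)\,dY$ (Lebesgue measure). Multi-dimensional Jacobi polynomials. For $\lambda=(\lambda_1\ge\dots\ge\lambda_p\ge0)$, $$Jac^\lambda_{z'-p,w'}(x_1,\dots,x_p)=\frac{\det\left[Jac^{\lambda_i+p-i}_{z'-p,w'}(x_j)\right]_{i,j=1,\dots,p}}{\prod_{i>j}(x_i-x_j)},$$ a symmetric polynomial, regarded as a function on $\mathcal W_p$. *)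

theory Defs
  imports "HOL-Analysis.Analysis" "Jordan_Normal_Form.Determinant"
begin

text \<open>
  A point \<open>(x\<^sub>1, \<dots>, x\<^sub>p)\<close> is an extensional function \<open>X\<close> on \<open>{..<p}\<close> with \<open>X i = x\<^sub>i\<^sub>+\<^sub>1\<close>, and a
  partition \<open>(\<lambda>\<^sub>1, \<dots>, \<lambda>\<^sub>p)\<close> is a function \<open>lam\<close> with \<open>lam i = \<lambda>\<^sub>i\<^sub>+\<^sub>1\<close> for \<open>i < p\<close>. So \<open>\<lambda>\<^sub>i + p - i\<close>
  becomes \<open>lam i + (p - Suc i)\<close>, and the case \<open>p = 0\<close> (a one-point space) is included.
\<close>

section \<open>Jacobi polynomials on the unit interval\<close>

definition jacobi :: "nat \<Rightarrow> real \<Rightarrow> real \<Rightarrow> real \<Rightarrow> real" where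
  "jacobi n \<alpha> \<beta> x =
     pochhammer (\<alpha> + 1) n / fact n *
     eval_fps (fps_hypergeo [- real n, real n + \<alpha> + \<beta> + 1] [\<alpha> + 1] 1) (1 - x)"

definition jac_weight :: "nat \<Rightarrow> real \<Rightarrow> real \<Rightarrow> real \<Rightarrow> real" where
  "jac_weight p z' w' x = x powr w' * (1 - x) powr (z' - real p)"

definition jac_inner :: "nat \<Rightarrow> real \<Rightarrow> real \<Rightarrow> (real \<Rightarrow> real) \<Rightarrow> (real \<Rightarrow> real) \<Rightarrow> real" where
  "jac_inner p z' w' f g = (LINT x:{0..1}|lborel. f x * g x * jac_weight p z' w' x)"

definition jac_fun :: "nat \<Rightarrow> real \<Rightarrow> real \<Rightarrow> nat \<Rightarrow> real \<Rightarrow> real" where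
  "jac_fun p z' w' k x =
     jacobi k (z' - real p) w' x * sqrt (jac_weight p z' w' x) /
     sqrt (jac_inner p z' w' (jacobi k (z' - real p) w') (jacobi k (z' - real p) w'))"

definition K_eig :: "nat \<Rightarrow> real \<Rightarrow> real \<Rightarrow> nat \<Rightarrow> real" where
  "K_eig p z' w' i = real i * (real i + w' + z' + 1 - real p)"

definition K_sum :: "nat \<Rightarrow> real \<Rightarrow> real \<Rightarrow> real" where
  "K_sum p z' w' = (\<Sum>i<p. K_eig p z' w' i)"

section \<open>The Markov semigroup on the ordered configurations\<close>

abbreviation lborel_pow :: "nat \<Rightarrow> (nat \<Rightarrow> real) measure" where
  "lborel_pow p \<equiv> PiM {..<p} (\<lambda>_. lborel)"

definition weyl :: "nat \<Rightarrow> (nat \<Rightarrow> real) set" where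
  "weyl p = {X \<in> {..<p} \<rightarrow>\<^sub>E {0..1}. mono_on {..<p} X}"

definition rho_unnorm :: "nat \<Rightarrow> real \<Rightarrow> real \<Rightarrow> (nat \<Rightarrow> real) \<Rightarrow> real" where
  "rho_unnorm p z' w' X =
     (\<Prod>j<p. \<Prod>i<j. (X i - X j)\<^sup>2) * (\<Prod>i<p. jac_weight p z' w' (X i))"

definition rho :: "nat \<Rightarrow> real \<Rightarrow> real \<Rightarrow> (nat \<Rightarrow> real) \<Rightarrow> real" where
  "rho p z' w' X = rho_unnorm p z' w' X / (LINT Y:weyl p|lborel_pow p. rho_unnorm p z' w' Y)"

definition mu :: "nat \<Rightarrow> real \<Rightarrow> real \<Rightarrow> (nat \<Rightarrow> real) measure" where
  "mu p z' w' = density (restrict_space (lborel_pow p) (weyl p)) (\<lambda>X. ennreal (rho p z' w' X))"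

text \<open>
  The first point argument \<open>Y\<close> is the target, the second one \<open>X\<close> the starting point.
\<close>

definition trans_dens ::
  "nat \<Rightarrow> real \<Rightarrow> real \<Rightarrow> real \<Rightarrow> (nat \<Rightarrow> real) \<Rightarrow> (nat \<Rightarrow> real) \<Rightarrow> real" where
  "trans_dens p z' w' t Y X =
     sqrt (rho p z' w' Y) / sqrt (rho p z' w' X) * exp (t * K_sum p z' w') *
     Determinant.det (Matrix.mat p p (\<lambda>(i, j).
       \<Sum>k. exp (- t * K_eig p z' w' k) * jac_fun p z' w' k (X i) * jac_fun p z' w' k (Y j)))"

definition markov_sg ::
  "nat \<Rightarrow> real \<Rightarrow> real \<Rightarrow> real \<Rightarrow> ((nat \<Rightarrow> real) \<Rightarrow> real) \<Rightarrow> (nat \<Rightarrow> real) \<Rightarrow> real" where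
  "markov_sg p z' w' t f X = (LINT Y:weyl p|lborel_pow p. f Y * trans_dens p z' w' t Y X)"

section \<open>Multi-dimensional Jacobi polynomials\<close>

text \<open>
  The quotient of the determinant by the Vandermonde product is a polynomial. At points with
  coinciding coordinates, where the quotient itself is \<open>0 / 0\<close>, the value of this polynomial is
  the limit of the quotient along points with pairwise distinct coordinates; at the latter points
  the limit is the quotient.
\<close>

definition multi_jacobi ::
  "nat \<Rightarrow> real \<Rightarrow> real \<Rightarrow> (nat \<Rightarrow> nat) \<Rightarrow> (nat \<Rightarrow> real) \<Rightarrow> real" where
  "multi_jacobi p \<alpha> \<beta> lam X =
     Lim (at X within {Y. inj_on Y {..<p}})
       (\<lambda>Y. Determinant.det
              (Matrix.mat p p (\<lambda>(i, j). jacobi (lam i + (p - Suc i)) \<alpha> \<beta> (Y j))) /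
            (\<Prod>i<p. \<Prod>j<i. Y i - Y j))"

section \<open>Eigenfunctions in an L2 space\<close>

definition L2_space :: "'a measure \<Rightarrow> ('a \<Rightarrow> real) set" where
  "L2_space M = {f \<in> borel_measurable M. integrable M (\<lambda>x. (f x)\<^sup>2)}"

text \<open>
  Elements of the L2 space are functions up to null sets, so nonvanishing and the eigenvalue
  equation are read almost everywhere.
\<close>

definition L2_eigenfunction ::
  "'a measure \<Rightarrow> (('a \<Rightarrow> real) \<Rightarrow> 'a \<Rightarrow> real) \<Rightarrow> real \<Rightarrow> ('a \<Rightarrow> real) \<Rightarrow> bool" where
  "L2_eigenfunction M T c f \<longleftrightarrow>
     f \<in> L2_space M \<and> \<not> (AE x in M. f x = 0) \<and> (AE x in M. T f x = c * f x)"

end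

theory Submission
  imports Defs "HOL-Real_Asymp.Real_Asymp"
begin

text \<open>
  The Vandermonde factor and the weights in \<open>trans_dens\<close> cancel against the denominator of the
  multi-dimensional Jacobi polynomial, so that applying the semigroup means integrating
  \<open>det [g\<^sub>i (y\<^sub>j)] det [k (x\<^sub>i, y\<^sub>j)]\<close> over the Weyl chamber, with \<open>g\<^sub>i\<close> a Jacobi polynomial times the
  square root of the weight and \<open>k\<close> the one-particle kernel. By the Andreief identity this is the
  determinant of the one-dimensional integrals, and orthogonality of the Jacobi polynomials makes
  every \<open>g\<^sub>i\<close> an eigenfunction of \<open>k\<close>. The same identity with \<open>k (x\<^sub>i, y)\<close> replaced by \<open>g\<^sub>i (y)\<close>
  computes the \<open>L\<^sub>2\<close> norm of the polynomial as a product of one-dimensional norms, which gives that it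
  is square integrable and not zero.
\<close>

subsection \<open>Divided differences and the multi-dimensional polynomials\<close>

text \<open>Three obstacles shape the proof. At points with coinciding coordinates the
  multi-dimensional polynomial is a limit, so it is first turned into a formula that is continuous
  in all coordinates; divided differences provide it. The kernel is an infinite series, and summing
  it under the integral needs a lower bound on the norms of the Jacobi polynomials next to an upper
  bound on their values. No closed form of the norm is used: bounds of the size k to the power O(k)
  lose against the Gaussian factor. Finally, \<open>trans_dens\<close> divides by zero where the
  stationary density vanishes; such starting points form a null set of \<open>mu\<close>, and the
  equation is proved at all other points of the chamber. Positivity of the normalization integral,
  on which the cancellation of the densities depends, is read off from the norm of the eigenfunction
  itself, without evaluating a Selberg integral.\<close>

primrec newton_quotient :: "real poly \<Rightarrow> (nat \<Rightarrow> real) \<Rightarrow> nat \<Rightarrow> real poly" where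
  "newton_quotient P Y 0 = P"
| "newton_quotient P Y (Suc j) = synthetic_div (newton_quotient P Y j) (Y j)"

text \<open>The classical divided difference of \<open>P\<close> at the nodes \<open>Y 0\<close>,
  ..., \<open>Y j\<close>. Iterated synthetic division keeps it meaningful when nodes coincide,
  where the usual difference quotients would divide by zero.\<close>

definition divided_difference :: "real poly \<Rightarrow> (nat \<Rightarrow> real) \<Rightarrow> nat \<Rightarrow> real" where
  "divided_difference P Y j = poly (newton_quotient P Y j) (Y j)"

lemma poly_synthetic_div:
  fixes P :: "real poly"
  shows "poly P x = poly P c + (x - c) * poly (synthetic_div P c) x"
proof -
  have "poly P x = poly ([:-c, 1:] * synthetic_div P c + [:poly P c:]) x"
    by (simp only: synthetic_div_correct')
  then show ?thesis by (simp add: algebra_simps)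
qed

text \<open>Each division peels off one term of the Newton form. The last summand is the remainder,
  which vanishes at the first \<open>n\<close> nodes.\<close>

lemma newton_interpolation:
  fixes P :: "real poly"
  shows "poly P x = (\<Sum>j<n. divided_difference P Y j * (\<Prod>i<j. x - Y i)) +
    poly (newton_quotient P Y n) x * (\<Prod>i<n. x - Y i)"
proof (induction n)
  case (Suc n)
  have "poly (newton_quotient P Y n) x =
      divided_difference P Y n + (x - Y n) * poly (newton_quotient P Y (Suc n)) x"
    using poly_synthetic_div[of "newton_quotient P Y n" x "Y n"]
    by (simp add: divided_difference_def)
  then show ?case
    by (simp add: Suc distrib_left distrib_right mult_ac del: newton_quotient.simps)
qed simp

text \<open>Newton interpolation at the points \<open>Y j\<close> factors the matrix into the
  divided differences and the matrix of Newton basis values. The latter is upper triangular, and its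
  diagonal multiplies to the Vandermonde product. The nodes may coincide.\<close>

lemma det_poly_vandermonde:
  fixes P :: "nat \<Rightarrow> real poly"
  shows "Determinant.det (Matrix.mat p p (\<lambda>(i, j). poly (P i) (Y j))) =
    Determinant.det (Matrix.mat p p (\<lambda>(i, j). divided_difference (P i) Y j)) *
    (\<Prod>i<p. \<Prod>j<i. Y i - Y j)"
proof -
  let ?D = "Matrix.mat p p (\<lambda>(i, j). divided_difference (P i) Y j)"
  let ?N = "Matrix.mat p p (\<lambda>(i, j). \<Prod>l<i. Y j - Y l)"
  have entry: "poly (P i) (Y j) = (\<Sum>k=0..<p. divided_difference (P i) Y k * (\<Prod>l<k. Y j - Y l))"
    if "j < p" for i j
  proof -
    have "(\<Prod>l<p. Y j - Y l) = 0" using that by (intro prod_zero) auto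
    then show ?thesis
      using newton_interpolation[of "P i" "Y j" Y p] by (simp add: lessThan_atLeast0)
  qed
  have "Matrix.mat p p (\<lambda>(i, j). poly (P i) (Y j)) = ?D * ?N"
    by (rule eq_matI) (auto simp: entry scalar_prod_def row_def col_def)
  then have "Determinant.det (Matrix.mat p p (\<lambda>(i, j). poly (P i) (Y j))) =
      Determinant.det ?D * Determinant.det ?N"
    by (metis det_mult mat_carrier)
  also have "Determinant.det ?N = prod_list (diag_mat ?N)"
  proof (rule det_upper_triangular[where n = p])
    show "upper_triangular ?N"
      unfolding upper_triangular_def by (auto intro!: prod_zero)
  qed simp
  also have "\<dots> = (\<Prod>i<p. \<Prod>j<i. Y i - Y j)"
    by (subst prod_list_diag_prod) (simp add: lessThan_atLeast0)
  finally show ?thesis .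
qed

lemma degree_newton_quotient: "degree (newton_quotient P Y j) \<le> degree P"
  by (induction j) (auto simp: degree_synthetic_div)

text \<open>Horner's scheme: the coefficients of the quotient are determined from the top
  downwards.\<close>

lemma coeff_synthetic_div:
  fixes P :: "real poly"
  shows "coeff (synthetic_div P c) n = coeff P (Suc n) + c * coeff (synthetic_div P c) (Suc n)"
proof -
  have "coeff (P + Polynomial.smult c (synthetic_div P c)) (Suc n) =
      coeff (pCons (poly P c) (synthetic_div P c)) (Suc n)"
    by (simp only: synthetic_div_correct)
  then show ?thesis by simp
qed

lemma continuous_coeff_newton_quotient:
  "continuous_on UNIV (\<lambda>Y. coeff (newton_quotient P Y j) i)"
proof (induction j arbitrary: i)
  case (Suc j)
  \<comment> \<open>Downward induction on the coefficient index: \<open>m\<close> is its distance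
    from \<open>Suc (degree P)\<close>, where the coefficient is zero for every
    \<open>Y\<close>.\<close>
  have "continuous_on UNIV (\<lambda>Y. coeff (newton_quotient P Y (Suc j)) i)"
    if "i + m = Suc (degree P)" for i m
    using that
  proof (induction m arbitrary: i)
    case 0
    have "coeff (newton_quotient P Y (Suc j)) i = 0" for Y
      using degree_newton_quotient[of P Y "Suc j"] 0 by (intro coeff_eq_0) simp
    then show ?case by (simp del: newton_quotient.simps)
  next
    case (Suc m)
    have *: "coeff (newton_quotient P Y (Suc j)) i =
        coeff (newton_quotient P Y j) (Suc i) + Y j * coeff (newton_quotient P Y (Suc j)) (Suc i)"
      for Y by (simp add: coeff_synthetic_div[of _ _ i])
    show ?case
      unfolding * using Suc.prems
      by (intro continuous_intros Suc.IH \<open>\<And>i. continuous_on UNIV (\<lambda>Y. coeff (newton_quotient P Y j) i)\<close>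
          continuous_on_product_coordinates) simp
  qed
  from this[of i "Suc (degree P) - i"] show ?case
  proof (cases "i \<le> Suc (degree P)")
    case False
    have "coeff (newton_quotient P Y (Suc j)) i = 0" for Y
      using degree_newton_quotient[of P Y "Suc j"] False by (intro coeff_eq_0) simp
    then show ?thesis by (simp del: newton_quotient.simps)
  qed simp
qed simp

lemma continuous_divided_difference: "continuous_on UNIV (\<lambda>Y. divided_difference P Y j)"
proof -
  \<comment> \<open>The degree of the quotient could vary with \<open>Y\<close>; summing up to
    \<open>degree P\<close> makes the index range independent of \<open>Y\<close>.\<close>
  have "divided_difference P Y j = (\<Sum>i\<le>degree P. coeff (newton_quotient P Y j) i * Y j ^ i)" for Y
    unfolding divided_difference_def poly_altdef
    using degree_newton_quotient[of P Y j]
    by (intro sum.mono_neutral_left) (auto simp: coeff_eq_0)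
  then show ?thesis
    by (simp add: continuous_on_sum continuous_on_mult continuous_on_power
        continuous_coeff_newton_quotient continuous_on_product_coordinates)
qed

lemma continuous_det:
  fixes A :: "nat \<Rightarrow> nat \<Rightarrow> 'a::topological_space \<Rightarrow> real"
  assumes "\<And>i j. i < n \<Longrightarrow> j < n \<Longrightarrow> continuous_on S (A i j)"
  shows "continuous_on S (\<lambda>Y. Determinant.det (Matrix.mat n n (\<lambda>(i, j). A i j Y)))"
proof -
  have "Determinant.det (Matrix.mat n n (\<lambda>(i, j). A i j Y)) =
      (\<Sum>\<pi>\<in>{\<pi>. \<pi> permutes {0..<n}}. signof \<pi> * (\<Prod>i=0..<n. A i (\<pi> i) Y))" for Y
    by (subst det_def'[where n = n]) (auto intro!: sum.cong prod.cong simp: permutes_in_image)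
  then show ?thesis
    using assms by (auto intro!: continuous_on_sum continuous_on_mult continuous_on_const
        continuous_on_prod simp: permutes_in_image)
qed

text \<open>\<open>Lim\<close> is determined by convergence only along a nontrivial filter. Moving
  coordinate \<open>i\<close> with speed \<open>i\<close> separates all coordinates for small
  nonzero times, so \<open>X\<close> is approached by injective points.\<close>

lemma at_within_inj_nontrivial:
  fixes X :: "nat \<Rightarrow> real"
  shows "at X within {Y. inj_on Y {..<p}} \<noteq> bot"
proof -
  define Z where "Z = (\<lambda>e i. X i + e * real i)"
  \<comment> \<open>The finitely many nonzero times at which two coordinates of \<open>Z e\<close>
    can collide; pairs with \<open>i = j\<close> only contribute the removed 0.\<close>
  define B where "B = (\<lambda>(i, j). (X i - X j) / (real j - real i)) ` ({..<p} \<times> {..<p}) - {0}"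
  have "continuous_on UNIV Z"
    unfolding Z_def by (intro continuous_on_coordinatewise_then_product continuous_intros)
  then have "(Z \<longlongrightarrow> Z 0) (at 0)"
    by (simp add: continuous_on_eq_continuous_at isCont_def)
  moreover have "Z 0 = X" by (simp add: Z_def)
  moreover have "\<forall>\<^sub>F e in at 0. inj_on (Z e) {..<p} \<and> Z e \<noteq> X"
  proof -
    have "finite B" by (simp add: B_def)
    then have "open (- B)" by (simp add: finite_imp_closed open_Compl)
    moreover have "0 \<in> - B" by (simp add: B_def)
    ultimately have "\<forall>\<^sub>F e in at 0. e \<in> - B - {0}"
      by (rule eventually_at_in_open)
    then show ?thesis
    proof eventually_elim
      case (elim e)
      \<comment> \<open>Coordinate 0 stands still. Coordinate 1 moves even if \<open>p\<close> is at
        most 1, because \<open>Z\<close> moves points of the full function space.\<close>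
      have "Z e 1 \<noteq> X 1" using elim by (simp add: Z_def)
      moreover have "inj_on (Z e) {..<p}"
      proof (rule inj_onI, rule ccontr)
        fix i j assume ij: "i \<in> {..<p}" "j \<in> {..<p}" "Z e i = Z e j" "i \<noteq> j"
        then have "e = (X i - X j) / (real j - real i)"
          by (simp add: Z_def field_simps)
        with ij elim show False by (auto simp: B_def)
      qed
      ultimately show ?case by auto
    qed
  qed
  ultimately have "filterlim Z (at X within {Y. inj_on Y {..<p}}) (at 0)"
    unfolding filterlim_at by simp
  then have le: "filtermap Z (at 0) \<le> at X within {Y. inj_on Y {..<p}}"
    unfolding filterlim_def .
  show ?thesis
  proof
    assume bot: "at X within {Y. inj_on Y {..<p}} = bot"
    have "filtermap Z (at 0) = bot"
      using le unfolding bot by (rule bot.extremum_uniqueI)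
    then have "at (0::real) = bot"
      unfolding filtermap_bot_iff .
    then show False
      using at_neq_bot[of "0::real"] by contradiction
  qed
qed

lemma vandermonde_nonzero_iff:
  fixes Y :: "nat \<Rightarrow> real"
  shows "(\<Prod>i<p. \<Prod>j<i. Y i - Y j) \<noteq> 0 \<longleftrightarrow> inj_on Y {..<p}"
proof -
  have "inj_on Y {..<p} \<longleftrightarrow> (\<forall>i<p. \<forall>j<i. Y i \<noteq> Y j)"
  proof (intro iffI allI impI)
    fix i j assume "inj_on Y {..<p}" "i < p" "j < i"
    then show "Y i \<noteq> Y j" using inj_onD[of Y "{..<p}" i j] by auto
  next
    assume *: "\<forall>i<p. \<forall>j<i. Y i \<noteq> Y j"
    show "inj_on Y {..<p}"
    proof (rule linorder_inj_onI')
      fix i j assume "i \<in> {..<p}" "j \<in> {..<p}" "i < j"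
      then show "Y i \<noteq> Y j" using * by force
    qed
  qed
  then show ?thesis by auto
qed

text \<open>The divided differences extend the defining quotient to the diagonals, so the limit there
  is their determinant.\<close>

lemma multi_jacobi_eq_det:
  assumes "\<And>n x. jacobi n \<alpha> \<beta> x = poly (P n) x"
  shows "multi_jacobi p \<alpha> \<beta> lam X =
    Determinant.det (Matrix.mat p p (\<lambda>(i, j). divided_difference (P (lam i + (p - Suc i))) X j))"
proof -
  let ?D = "\<lambda>Y. Determinant.det
    (Matrix.mat p p (\<lambda>(i, j). divided_difference (P (lam i + (p - Suc i))) Y j))"
  let ?q = "\<lambda>Y. Determinant.det
      (Matrix.mat p p (\<lambda>(i, j). jacobi (lam i + (p - Suc i)) \<alpha> \<beta> (Y j))) /
      (\<Prod>i<p. \<Prod>j<i. Y i - Y j)"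
  have "?q Y = ?D Y" if "inj_on Y {..<p}" for Y
    unfolding assms det_poly_vandermonde using vandermonde_nonzero_iff[of Y p] that by simp
  then have ev: "\<forall>\<^sub>F Y in at X within {Y. inj_on Y {..<p}}. ?D Y = ?q Y"
    by (auto simp: eventually_at_topological)
  have "continuous_on UNIV ?D"
    by (intro continuous_det continuous_divided_difference)
  then have "(?D \<longlongrightarrow> ?D X) (at X within {Y. inj_on Y {..<p}})"
    by (meson continuous_on_def tendsto_within_subset UNIV_I subset_UNIV)
  then have "(?q \<longlongrightarrow> ?D X) (at X within {Y. inj_on Y {..<p}})"
    by (rule Lim_transform_eventually) (rule ev)
  then show ?thesis
    unfolding multi_jacobi_def by (intro tendsto_Lim at_within_inj_nontrivial)
qed

lemma multi_jacobi_eq_quotient: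
  assumes "\<And>n x. jacobi n \<alpha> \<beta> x = poly (P n) x" and "inj_on X {..<p}"
  shows "multi_jacobi p \<alpha> \<beta> lam X =
    Determinant.det (Matrix.mat p p (\<lambda>(i, j). jacobi (lam i + (p - Suc i)) \<alpha> \<beta> (X j))) /
      (\<Prod>i<p. \<Prod>j<i. X i - X j)"
proof -
  have "(\<Prod>i<p. \<Prod>j<i. X i - X j) \<noteq> 0"
    using vandermonde_nonzero_iff[of X p] assms(2) by blast
  then show ?thesis
    unfolding multi_jacobi_eq_det[where P = P, OF assms(1)] assms(1) det_poly_vandermonde
    by (rule nonzero_mult_div_cancel_right[symmetric])
qed

lemma measurable_lborel_pow_component:
  assumes "i < p"
  shows "(\<lambda>X. X i) \<in> borel_measurable (lborel_pow p)"
  using assms measurable_component_singleton[of i "{..<p}" "\<lambda>_. lborel :: real measure"] by simp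

lemma measurable_multi_jacobi:
  assumes "\<And>n x. jacobi n \<alpha> \<beta> x = poly (P n) x"
  shows "multi_jacobi p \<alpha> \<beta> lam \<in> borel_measurable (lborel_pow p)"
proof -
  have eq: "multi_jacobi p \<alpha> \<beta> lam = (\<lambda>X. Determinant.det
      (Matrix.mat p p (\<lambda>(i, j). divided_difference (P (lam i + (p - Suc i))) X j)))"
    by (rule ext) (rule multi_jacobi_eq_det[OF assms])
  have "continuous_on UNIV (multi_jacobi p \<alpha> \<beta> lam)"
    unfolding eq by (rule continuous_det) (rule continuous_divided_difference)
  then have meas: "multi_jacobi p \<alpha> \<beta> lam \<in> borel_measurable borel"
    by (rule borel_measurable_continuous_onI)
  \<comment> \<open>Continuity refers to the product topology on all functions, whereas points of
    \<open>lborel_pow p\<close> are extensional. Their coordinates from \<open>p\<close> on are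
    constantly \<open>undefined\<close>, hence the inclusion is measurable.\<close>
  have "(\<lambda>X. X) \<in> lborel_pow p \<rightarrow>\<^sub>M PiM UNIV (\<lambda>_. borel :: real measure)"
  proof (rule measurable_PiM_single')
    fix i :: nat
    show "(\<lambda>X. X i) \<in> borel_measurable (lborel_pow p)"
    proof (cases "i < p")
      case False
      have "(\<lambda>X. X i) \<in> borel_measurable (lborel_pow p) \<longleftrightarrow>
          (\<lambda>X. undefined :: real) \<in> borel_measurable (lborel_pow p)"
      proof (rule measurable_cong)
        fix X assume "X \<in> space (lborel_pow p)"
        then have "X \<in> {..<p} \<rightarrow>\<^sub>E UNIV" by (simp add: space_PiM)
        then show "X i = undefined" using False PiE_arb[of X "{..<p}" _ i] by simp
      qed
      then show ?thesis by simp
    next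
      case True
      then show ?thesis by (rule measurable_lborel_pow_component)
    qed
  qed simp
  then have "(\<lambda>X. X) \<in> lborel_pow p \<rightarrow>\<^sub>M (borel :: (nat \<Rightarrow> real) measure)"
    unfolding measurable_cong_sets[OF refl sets_PiM_equal_borel] .
  from measurable_compose[OF this meas] show ?thesis .
qed

subsection \<open>The Andreief identity on the Weyl chamber\<close>

lemma measurable_PiM_permute:
  assumes \<pi>: "\<pi> permutes I"
  shows "(\<lambda>Y. Y \<circ> \<pi>) \<in> PiM I (\<lambda>_. M) \<rightarrow>\<^sub>M PiM I (\<lambda>_. M)"
proof (rule measurable_PiM_single')
  fix i assume "i \<in> I"
  then show "(\<lambda>Y. (Y \<circ> \<pi>) i) \<in> PiM I (\<lambda>_. M) \<rightarrow>\<^sub>M M"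
    using permutes_in_image[OF \<pi>] by (auto simp: o_def)
next
  show "(\<lambda>Y. Y \<circ> \<pi>) \<in> space (PiM I (\<lambda>_. M)) \<rightarrow> (\<Pi>\<^sub>E i\<in>I. space M)"
    using permutes_in_image[OF \<pi>] by (auto simp: space_PiM PiE_def Pi_def extensional_def)
qed

text \<open>Boxes determine the product measure. The preimage of a box is the box with permuted
  sides, whose measure is the same product in another order.\<close>

lemma distr_PiM_permute:
  fixes M :: "'a measure" and I :: "'i set"
  assumes "sigma_finite_measure M" and I: "finite I" and \<pi>: "\<pi> permutes I"
  shows "distr (PiM I (\<lambda>_. M)) (PiM I (\<lambda>_. M)) (\<lambda>Y. Y \<circ> \<pi>) = PiM I (\<lambda>_. M)"
proof -
  interpret product_sigma_finite "\<lambda>_::'i. M"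
    using assms(1) by (simp add: product_sigma_finite_def)
  have mem: "\<pi> i \<in> I \<longleftrightarrow> i \<in> I" "inv_into UNIV \<pi> i \<in> I \<longleftrightarrow> i \<in> I" for i
    using \<pi> permutes_in_image[OF \<pi>] permutes_in_image[OF permutes_inv[OF \<pi>]] by auto
  note meas = measurable_PiM_permute[OF \<pi>, of M]
  show ?thesis
  proof (rule PiM_eqI)
    fix A :: "'i \<Rightarrow> 'a set" assume A: "\<And>i. i \<in> I \<Longrightarrow> A i \<in> sets M"
    have vim: "(\<lambda>Y. Y \<circ> \<pi>) -` Pi\<^sub>E I A \<inter> space (PiM I (\<lambda>_. M)) = Pi\<^sub>E I (\<lambda>i. A (inv_into UNIV \<pi> i))"
    proof (rule Set.set_eqI, rule iffI)
      fix Y assume Y: "Y \<in> (\<lambda>Y. Y \<circ> \<pi>) -` Pi\<^sub>E I A \<inter> space (PiM I (\<lambda>_. M))"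
      have "Y i \<in> A (inv_into UNIV \<pi> i)" if "i \<in> I" for i
      proof -
        have "(Y \<circ> \<pi>) (inv_into UNIV \<pi> i) \<in> A (inv_into UNIV \<pi> i)"
          using PiE_mem[of "Y \<circ> \<pi>" I A "inv_into UNIV \<pi> i"] Y that mem(2) by blast
        then show ?thesis using permutes_inverses[OF \<pi>] by simp
      qed
      then show "Y \<in> Pi\<^sub>E I (\<lambda>i. A (inv_into UNIV \<pi> i))"
        using Y by (auto simp: space_PiM PiE_def)
    next
      fix Y assume Y: "Y \<in> Pi\<^sub>E I (\<lambda>i. A (inv_into UNIV \<pi> i))"
      have "Y (\<pi> i) \<in> A i" if "i \<in> I" for i
        using PiE_mem[OF Y, of "\<pi> i"] that mem permutes_inverses[OF \<pi>] by simp
      moreover have "Y i \<in> space M" if "i \<in> I" for i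
        using PiE_mem[OF Y, of i] that mem A[of "inv_into UNIV \<pi> i"] sets.sets_into_space by blast
      ultimately show "Y \<in> (\<lambda>Y. Y \<circ> \<pi>) -` Pi\<^sub>E I A \<inter> space (PiM I (\<lambda>_. M))"
        using Y mem by (auto simp: space_PiM PiE_def Pi_def extensional_def)
    qed
    have "emeasure (distr (PiM I (\<lambda>_. M)) (PiM I (\<lambda>_. M)) (\<lambda>Y. Y \<circ> \<pi>)) (Pi\<^sub>E I A) =
        emeasure (PiM I (\<lambda>_. M)) (Pi\<^sub>E I (\<lambda>i. A (inv_into UNIV \<pi> i)))"
      using A I by (subst emeasure_distr[OF meas]) (auto simp: vim intro!: sets_PiM_I_finite)
    also have "\<dots> = (\<Prod>i\<in>I. emeasure M (A (inv_into UNIV \<pi> i)))"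
      using A mem I by (intro emeasure_PiM) auto
    also have "\<dots> = (\<Prod>i\<in>I. emeasure M (A i))"
      using prod.permute[OF permutes_inv[OF \<pi>], of "\<lambda>i. emeasure M (A i)"] by (simp add: o_def)
    finally show "emeasure (distr (PiM I (\<lambda>_. M)) (PiM I (\<lambda>_. M)) (\<lambda>Y. Y \<circ> \<pi>)) (Pi\<^sub>E I A) =
        (\<Prod>i\<in>I. emeasure M (A i))" .
  qed (use I in auto)
qed

lemma
  fixes g :: "(nat \<Rightarrow> real) \<Rightarrow> real"
  assumes \<pi>: "\<pi> permutes {..<p}" and g: "g \<in> borel_measurable (lborel_pow p)"
  shows integrable_lborel_pow_permute:
      "integrable (lborel_pow p) (\<lambda>Y. g (Y \<circ> \<pi>)) \<longleftrightarrow> integrable (lborel_pow p) g"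
    and integral_lborel_pow_permute:
      "(\<integral>Y. g (Y \<circ> \<pi>) \<partial>lborel_pow p) = (\<integral>Y. g Y \<partial>lborel_pow p)"
proof -
  have d: "distr (lborel_pow p) (lborel_pow p) (\<lambda>Y. Y \<circ> \<pi>) = lborel_pow p"
    using \<pi> by (intro distr_PiM_permute sigma_finite_lborel) auto
  note m = measurable_PiM_permute[OF \<pi>, of "lborel :: real measure"]
  show "integrable (lborel_pow p) (\<lambda>Y. g (Y \<circ> \<pi>)) \<longleftrightarrow> integrable (lborel_pow p) g"
    using integrable_distr_eq[OF m g] by (simp add: d)
  show "(\<integral>Y. g (Y \<circ> \<pi>) \<partial>lborel_pow p) = (\<integral>Y. g Y \<partial>lborel_pow p)"
    using integral_distr[OF m g] by (simp add: d)
qed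

section \<open>Sorting, and the tiling of the cube by the permuted chambers\<close>

lemma strict_mono_on_lessThan_unique:
  fixes f g :: "nat \<Rightarrow> 'a::linorder"
  assumes f: "strict_mono_on {..<n} f" and g: "strict_mono_on {..<n} g"
    and eq: "f ` {..<n} = g ` {..<n}" and i: "i < n"
  shows "f i = g i"
proof -
  \<comment> \<open>A value is identified by its rank: exactly \<open>j\<close> elements of the
    image lie below \<open>h j\<close>.\<close>
  have rank: "card {a \<in> h ` {..<n}. a < h j} = j" if h: "strict_mono_on {..<n} h" and "j < n"
    for h :: "nat \<Rightarrow> 'a" and j
  proof -
    have "{a \<in> h ` {..<n}. a < h j} = h ` {..<j}"
      using h \<open>j < n\<close> by (auto simp: strict_mono_on_less)
    moreover have "inj_on h {..<j}"
      by (rule inj_on_subset[OF strict_mono_on_imp_inj_on[OF h]]) (use \<open>j < n\<close> in simp)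
    ultimately show ?thesis by (simp add: card_image)
  qed
  obtain j where j: "j < n" "f i = g j" using eq i by auto
  have "i = j" using rank[OF f i] rank[OF g j(1)] by (simp add: eq j(2))
  then show ?thesis using j by simp
qed

text \<open>The permutation sorts \<open>Y\<close>. It is unique because distinct coordinates make
  the sorted sequence strictly increasing, hence determined by its set of values.\<close>

lemma ex1_permutes_weyl:
  assumes inj: "inj_on Y {..<p}" and Y: "Y \<in> {..<p} \<rightarrow>\<^sub>E {0..1}"
  shows "\<exists>!\<pi>. \<pi> permutes {..<p} \<and> Y \<circ> \<pi> \<in> weyl p"
proof -
  let ?A = "Y ` {..<p}"
  define h where "h = nth (sorted_list_of_set ?A)"
  have len: "length (sorted_list_of_set ?A) = p"
    using card_image[OF inj] by simp
  have h: "bij_betw h {..<p} ?A" "strict_mono_on {..<p} h"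
    unfolding h_def
    using bij_betw_nth[of "sorted_list_of_set ?A" "{..<p}" ?A] len
      sorted_wrt_nth_less[OF strict_sorted_list_of_set[of ?A]]
    by (auto simp: strict_mono_on_def)
  define \<pi> where "\<pi> = (\<lambda>i. if i < p then inv_into {..<p} Y (h i) else i)"
  have "bij_betw (inv_into {..<p} Y \<circ> h) {..<p} {..<p}"
    using bij_betw_trans[OF h(1) bij_betw_inv_into[OF inj_on_imp_bij_betw[OF inj]]] .
  then have "bij_betw \<pi> {..<p} {..<p}"
    by (rule bij_betw_cong[THEN iffD1, rotated]) (simp add: \<pi>_def)
  then have perm: "\<pi> permutes {..<p}"
    by (rule bij_imp_permutes) (simp add: \<pi>_def)
  have Yh: "Y (\<pi> i) = h i" if "i < p" for i
    using that h(1) f_inv_into_f[of "h i" Y "{..<p}"] by (auto simp: \<pi>_def bij_betw_def)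
  have weyl: "Y \<circ> \<sigma> \<in> weyl p \<longleftrightarrow> mono_on {..<p} (Y \<circ> \<sigma>)" if "\<sigma> permutes {..<p}" for \<sigma>
    using Y permutes_in_image[OF that] unfolding weyl_def
    by (auto simp: PiE_def Pi_def extensional_def)
  show ?thesis
  proof (intro ex1I conjI)
    show "\<pi> permutes {..<p}" by (rule perm)
    have "mono_on {..<p} (Y \<circ> \<pi>)"
      using strict_mono_on_imp_mono_on[OF h(2)] by (auto simp: mono_on_def Yh)
    then show "Y \<circ> \<pi> \<in> weyl p" by (simp add: weyl perm)
  next
    fix \<sigma> assume \<sigma>: "\<sigma> permutes {..<p} \<and> Y \<circ> \<sigma> \<in> weyl p"
    have img: "(Y \<circ> \<sigma>) ` {..<p} = ?A"
      using permutes_image[of \<sigma> "{..<p}"] \<sigma> by (metis image_comp)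
    have inj\<sigma>: "inj_on (Y \<circ> \<sigma>) {..<p}"
      using \<sigma> inj permutes_image[of \<sigma> "{..<p}"] permutes_inj_on by (metis comp_inj_on)
    have "strict_mono_on {..<p} (Y \<circ> \<sigma>)"
      using \<sigma> weyl inj\<sigma> unfolding strict_mono_on_def mono_on_def inj_on_def
      by (metis less_le)
    then have eq: "(Y \<circ> \<sigma>) i = h i" if "i < p" for i
      using strict_mono_on_lessThan_unique[OF _ h(2)] that img h(1) by (auto simp: bij_betw_def)
    show "\<sigma> = \<pi>"
    proof
      fix i
      show "\<sigma> i = \<pi> i"
      proof (cases "i < p")
        case True
        then have "Y (\<sigma> i) = Y (\<pi> i)" using eq Yh by simp
        then show ?thesis
          using inj True permutes_in_image[of \<sigma> "{..<p}" i] permutes_in_image[OF perm, of i] \<sigma>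
          by (auto simp: inj_on_def)
      next
        case False
        then show ?thesis using \<sigma> perm by (auto simp: permutes_def)
      qed
    qed
  qed
qed

lemma sum_indicator_weyl_permute:
  assumes "inj_on Y {..<p}" and "Y \<in> {..<p} \<rightarrow>\<^sub>E {0..1}"
  shows "(\<Sum>\<pi> | \<pi> permutes {..<p}. indicator (weyl p) (Y \<circ> \<pi>)) = (1::real)"
proof -
  obtain \<pi> where \<pi>: "\<pi> permutes {..<p}" "Y \<circ> \<pi> \<in> weyl p"
    and u: "\<And>\<sigma>. \<sigma> permutes {..<p} \<Longrightarrow> Y \<circ> \<sigma> \<in> weyl p \<Longrightarrow> \<sigma> = \<pi>"
    using ex1_permutes_weyl[OF assms] by auto
  have "(\<Sum>\<sigma> | \<sigma> permutes {..<p}. indicator (weyl p) (Y \<circ> \<sigma>)) =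
      (\<Sum>\<sigma> | \<sigma> permutes {..<p}. if \<sigma> = \<pi> then 1 else (0::real))"
  proof (rule sum.cong)
    fix \<sigma> assume "\<sigma> \<in> {\<sigma>. \<sigma> permutes {..<p}}"
    then show "indicator (weyl p) (Y \<circ> \<sigma>) = (if \<sigma> = \<pi> then 1 else (0::real))"
      using \<pi>(2) u[of \<sigma>] by (cases "Y \<circ> \<sigma> \<in> weyl p") (simp_all, metis)
  qed simp
  then show ?thesis using \<pi> by (simp add: sum.delta finite_permutations)
qed

lemma sets_weyl: "weyl p \<in> sets (lborel_pow p)"
proof -
  note m = measurable_lborel_pow_component
  have box: "{X \<in> space (lborel_pow p). i < p \<longrightarrow> 0 \<le> X i \<and> X i \<le> 1} \<in> sets (lborel_pow p)" for i
  proof (cases "i < p")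
    case True
    then show ?thesis
      using m[OF True] by (simp add: sets.sets_Collect_conj borel_measurable_le)
  qed simp
  have ordered: "{X \<in> space (lborel_pow p). i < p \<and> j < p \<and> i \<le> j \<longrightarrow> X i \<le> X j}
      \<in> sets (lborel_pow p)" for i j
  proof (cases "i < p \<and> j < p \<and> i \<le> j")
    case True
    then show ?thesis using m by (simp add: borel_measurable_le)
  next
    case False
    then have "{X \<in> space (lborel_pow p). i < p \<and> j < p \<and> i \<le> j \<longrightarrow> X i \<le> X j} =
        space (lborel_pow p)" by blast
    then show ?thesis by simp
  qed
  have "weyl p = {X \<in> space (lborel_pow p). (\<forall>i. i < p \<longrightarrow> 0 \<le> X i \<and> X i \<le> 1) \<and>
      (\<forall>i j. i < p \<and> j < p \<and> i \<le> j \<longrightarrow> X i \<le> X j)}"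
    by (auto simp: weyl_def space_PiM mono_on_def PiE_def Pi_def)
  also have "\<dots> \<in> sets (lborel_pow p)"
    by (intro sets.sets_Collect_conj sets.sets_Collect_countable_All box ordered)
  finally show ?thesis .
qed

section \<open>Determinants of matrices whose columns are evaluations at points\<close>

lemma det_mat_lessThan:
  "Determinant.det (Matrix.mat n n (\<lambda>(i, j). a i j)) =
    (\<Sum>\<pi> | \<pi> permutes {..<n}. signof \<pi> * (\<Prod>i<n. a i (\<pi> i)))"
  by (subst det_def'[where n = n])
    (auto intro!: sum.cong prod.cong simp: permutes_in_image lessThan_atLeast0)

lemma det_mat_columns_permute:
  fixes h :: "nat \<Rightarrow> 'b \<Rightarrow> real"
  assumes \<pi>: "\<pi> permutes {..<n}"
  shows "Determinant.det (Matrix.mat n n (\<lambda>(i, j). h i (Y (\<pi> j)))) =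
    signof \<pi> * Determinant.det (Matrix.mat n n (\<lambda>(i, j). h i (Y j)))"
proof -
  \<comment> \<open>The permutation rule at hand concerns rows, so the matrix is transposed to let
    points index rows.\<close>
  let ?A = "\<lambda>Y. Matrix.mat n n (\<lambda>(i, j). h j (Y i))"
  have tr: "Determinant.det (Matrix.mat n n (\<lambda>(i, j). h i (Y j))) = Determinant.det (?A Y)" for Y
  proof -
    have "transpose_mat (?A Y) = Matrix.mat n n (\<lambda>(i, j). h i (Y j))"
      by (rule eq_matI) auto
    then show ?thesis using det_transpose[of "?A Y" n] by simp
  qed
  have "?A (\<lambda>j. Y (\<pi> j)) = Matrix.mat n n (\<lambda>(i, j). ?A Y $$ (\<pi> i, j))"
    using permutes_in_image[OF \<pi>] by (intro eq_matI) auto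
  then show ?thesis
    using det_permute_rows[of "?A Y" n \<pi>] \<pi> unfolding tr by (simp add: lessThan_atLeast0)
qed

lemma det_mat_eq_0_if_not_inj:
  assumes "\<not> inj_on Y {..<n}"
  shows "Determinant.det (Matrix.mat n n (\<lambda>(i, j). h i (Y j) :: real)) = 0"
proof -
  obtain i j where ij: "i < n" "j < n" "i \<noteq> j" "Y i = Y j"
    using assms by (auto simp: inj_on_def)
  show ?thesis
    by (rule det_identical_columns[where n = n and i = i and j = j])
      (use ij in \<open>auto intro!: eq_vecI simp: col_def\<close>)
qed

text \<open>Expanding the first determinant gives a sum over the permutations \<open>\<pi>\<close> of
  \<open>\<Psi> (Y \<circ> \<pi>)\<close>, where \<open>\<Psi>\<close> vanishes off the cube and where two
  coordinates agree. As the images of the chamber tile the cube, the integral over the chamber is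
  the integral of \<open>\<Psi>\<close> over the whole space.\<close>

lemma andreief_weyl:
  fixes g h :: "nat \<Rightarrow> real \<Rightarrow> real"
  assumes int: "\<And>i k. i < p \<Longrightarrow> k < p \<Longrightarrow> integrable lborel (\<lambda>y. g i y * h k y)"
    and supp: "\<And>i y. i < p \<Longrightarrow> y \<notin> {0..1} \<Longrightarrow> g i y = 0"
  defines "G \<equiv> \<lambda>Y. Determinant.det (Matrix.mat p p (\<lambda>(i, j). g i (Y j))) *
    Determinant.det (Matrix.mat p p (\<lambda>(i, j). h i (Y j)))"
  shows "set_integrable (lborel_pow p) (weyl p) G"
    and "(LINT Y:weyl p|lborel_pow p. G Y) =
      Determinant.det (Matrix.mat p p (\<lambda>(i, j). \<integral>y. g i y * h j y \<partial>lborel))"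
proof -
  interpret product_sigma_finite "\<lambda>_::nat. lborel :: real measure"
    by standard
  let ?\<nu> = "lborel_pow p" and ?S = "{\<pi>. \<pi> permutes {..<p}}"
  define \<Psi> where "\<Psi> = (\<lambda>Y. (\<Prod>i<p. g i (Y i)) *
    Determinant.det (Matrix.mat p p (\<lambda>(i, j). h i (Y j))))"
  have fin: "finite ?S" by (simp add: finite_permutations)
  \<comment> \<open>Expanding the transposed determinant makes every summand a product over
    \<open>i\<close> of functions of \<open>Y i\<close> alone, which is the form that the product
    integral rules accept.\<close>
  have \<Psi>_sum: "\<Psi> Y = (\<Sum>\<tau>\<in>?S. signof \<tau> * (\<Prod>i<p. g i (Y i) * h (\<tau> i) (Y i)))" for Y
  proof -
    have "Determinant.det (Matrix.mat p p (\<lambda>(i, j). h i (Y j))) =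
        Determinant.det (transpose_mat (Matrix.mat p p (\<lambda>(i, j). h i (Y j))))"
      by (subst det_transpose) auto
    also have "transpose_mat (Matrix.mat p p (\<lambda>(i, j). h i (Y j))) =
        Matrix.mat p p (\<lambda>(i, j). h j (Y i))"
      by (rule eq_matI) auto
    finally show ?thesis
      unfolding \<Psi>_def
      by (simp add: det_mat_lessThan[of p "\<lambda>i j. h j (Y i)"] sum_distrib_left prod.distrib mult_ac)
  qed
  have int_prod: "integrable ?\<nu> (\<lambda>Y. \<Prod>i<p. g i (Y i) * h (\<tau> i) (Y i))" if "\<tau> \<in> ?S" for \<tau>
    using that permutes_in_image[of \<tau> "{..<p}"] int
    by (intro product_integrable_prod[where f = "\<lambda>i y. g i y * h (\<tau> i) y"]) auto
  have int_\<Psi>: "integrable ?\<nu> \<Psi>"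
    unfolding \<Psi>_sum[abs_def]
    by (intro Bochner_Integration.integrable_sum Bochner_Integration.integrable_mult_right int_prod)
  have \<Psi>_meas: "\<Psi> \<in> borel_measurable ?\<nu>" using int_\<Psi> by auto
  have ind_meas: "(indicator (weyl p) :: _ \<Rightarrow> real) \<in> borel_measurable ?\<nu>"
    using sets_weyl by simp
  \<comment> \<open>The sign of each \<open>\<pi>\<close> in the Leibniz expansion is absorbed by
    permuting the columns of the second determinant.\<close>
  have G_sum: "G Y = (\<Sum>\<pi>\<in>?S. \<Psi> (Y \<circ> \<pi>))" for Y
    unfolding G_def \<Psi>_def det_mat_lessThan[of p "\<lambda>i j. g i (Y j)"] sum_distrib_right
  proof (intro sum.cong refl)
    fix \<pi> assume "\<pi> \<in> ?S"
    then show "signof \<pi> * (\<Prod>i<p. g i (Y (\<pi> i))) *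
          Determinant.det (Matrix.mat p p (\<lambda>(i, j). h i (Y j))) =
        (\<Prod>i<p. g i ((Y \<circ> \<pi>) i)) *
          Determinant.det (Matrix.mat p p (\<lambda>(i, j). h i ((Y \<circ> \<pi>) j)))"
      by (simp add: det_mat_columns_permute)
  qed
  have inv_comp: "Y \<circ> \<pi> \<circ> inv_into UNIV \<pi> = Y" if "\<pi> \<in> ?S" for Y :: "nat \<Rightarrow> real" and \<pi>
    using that by (simp add: comp_assoc permutes_inv_o)
  have int_term: "integrable ?\<nu> (\<lambda>Y. indicator (weyl p) (Y \<circ> inv_into UNIV \<pi>) * \<Psi> Y)"
    if "\<pi> \<in> ?S" for \<pi>
  proof (rule Bochner_Integration.integrable_bound[OF int_\<Psi>])
    show "(\<lambda>Y. indicator (weyl p) (Y \<circ> inv_into UNIV \<pi>) * \<Psi> Y) \<in> borel_measurable ?\<nu>"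
      using measurable_compose[OF measurable_PiM_permute[OF permutes_inv] ind_meas]
        that by (intro borel_measurable_times \<Psi>_meas) blast
  qed (auto simp: indicator_def)
  \<comment> \<open>The change of variables moves the permutation from \<open>\<Psi>\<close> to the
    indicator; afterwards the indicators can be summed in front of a common factor.\<close>
  have int_term': "integrable ?\<nu> (\<lambda>Y. indicator (weyl p) Y * \<Psi> (Y \<circ> \<pi>))"
    and eq_term: "(\<integral>Y. indicator (weyl p) Y * \<Psi> (Y \<circ> \<pi>) \<partial>?\<nu>) =
      (\<integral>Y. indicator (weyl p) (Y \<circ> inv_into UNIV \<pi>) * \<Psi> Y \<partial>?\<nu>)" if \<pi>: "\<pi> \<in> ?S" for \<pi>
  proof -
    let ?g = "\<lambda>Y. indicator (weyl p) (Y \<circ> inv_into UNIV \<pi>) * \<Psi> Y :: real"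
    have m: "?g \<in> borel_measurable ?\<nu>" using int_term[OF \<pi>] by auto
    have p: "\<pi> permutes {..<p}" using \<pi> by simp
    show "integrable ?\<nu> (\<lambda>Y. indicator (weyl p) Y * \<Psi> (Y \<circ> \<pi>))"
      using integrable_lborel_pow_permute[OF p m] int_term[OF \<pi>] inv_comp[OF \<pi>] by simp
    show "(\<integral>Y. indicator (weyl p) Y * \<Psi> (Y \<circ> \<pi>) \<partial>?\<nu>) = (\<integral>Y. ?g Y \<partial>?\<nu>)"
      using integral_lborel_pow_permute[OF p m] inv_comp[OF \<pi>] by simp
  qed
  have G_ind: "indicator (weyl p) Y * G Y = (\<Sum>\<pi>\<in>?S. indicator (weyl p) Y * \<Psi> (Y \<circ> \<pi>))" for Y
    by (simp add: G_sum sum_distrib_left)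
  show "set_integrable ?\<nu> (weyl p) G"
    unfolding set_integrable_def real_scaleR_def G_ind
    by (intro Bochner_Integration.integrable_sum int_term')
  have tile: "(\<Sum>\<pi>\<in>?S. indicator (weyl p) (Y \<circ> inv_into UNIV \<pi>)) * \<Psi> Y = \<Psi> Y"
    if Y: "Y \<in> space ?\<nu>" for Y
  proof (cases "inj_on Y {..<p} \<and> Y \<in> {..<p} \<rightarrow>\<^sub>E {0..1}")
    case True
    have "(\<Sum>\<pi>\<in>?S. indicator (weyl p) (Y \<circ> inv_into UNIV \<pi>)) =
        (\<Sum>\<pi>\<in>?S. indicator (weyl p) (Y \<circ> \<pi>) :: real)"
      by (rule sum_permutations_inverse[symmetric])
    then show ?thesis using sum_indicator_weyl_permute[of Y p] True by simp
  next
    case False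
    then consider "\<not> inj_on Y {..<p}" | "Y \<notin> {..<p} \<rightarrow>\<^sub>E {0..1}" by blast
    then have "\<Psi> Y = 0"
    proof cases
      case 1
      then show ?thesis by (simp add: \<Psi>_def det_mat_eq_0_if_not_inj)
    next
      case 2
      then obtain i where "i < p" "Y i \<notin> {0..1}"
        using Y by (auto simp: space_PiM PiE_def Pi_def)
      then have "(\<Prod>i<p. g i (Y i)) = 0" using supp by (intro prod_zero) auto
      then show ?thesis by (simp add: \<Psi>_def)
    qed
    then show ?thesis by simp
  qed
  have "(LINT Y:weyl p|?\<nu>. G Y) = (\<Sum>\<pi>\<in>?S. \<integral>Y. indicator (weyl p) Y * \<Psi> (Y \<circ> \<pi>) \<partial>?\<nu>)"
    unfolding set_lebesgue_integral_def real_scaleR_def G_ind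
    by (intro Bochner_Integration.integral_sum int_term')
  also have "\<dots> = (\<Sum>\<pi>\<in>?S. \<integral>Y. indicator (weyl p) (Y \<circ> inv_into UNIV \<pi>) * \<Psi> Y \<partial>?\<nu>)"
    by (intro sum.cong refl eq_term)
  also have "\<dots> = (\<integral>Y. (\<Sum>\<pi>\<in>?S. indicator (weyl p) (Y \<circ> inv_into UNIV \<pi>) * \<Psi> Y) \<partial>?\<nu>)"
    by (intro Bochner_Integration.integral_sum[symmetric] int_term)
  also have "\<dots> = (\<integral>Y. \<Psi> Y \<partial>?\<nu>)"
    by (intro Bochner_Integration.integral_cong refl)
      (simp add: sum_distrib_right[symmetric] tile)
  also have "\<dots> = (\<Sum>\<tau>\<in>?S. signof \<tau> * (\<Prod>i<p. \<integral>y. g i y * h (\<tau> i) y \<partial>lborel))"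
  proof -
    have "(\<integral>Y. \<Psi> Y \<partial>?\<nu>) =
        (\<Sum>\<tau>\<in>?S. signof \<tau> * (\<integral>Y. (\<Prod>i<p. g i (Y i) * h (\<tau> i) (Y i)) \<partial>?\<nu>))"
      unfolding \<Psi>_sum using int_prod by (subst Bochner_Integration.integral_sum) auto
    also have "\<dots> = (\<Sum>\<tau>\<in>?S. signof \<tau> * (\<Prod>i<p. \<integral>y. g i y * h (\<tau> i) y \<partial>lborel))"
      using permutes_in_image[of _ "{..<p}"] int
      by (intro sum.cong refl arg_cong2[where f = "(*)"]
          product_integral_prod[where f = "\<lambda>i y. g i y * h (_ i) y"]) auto
    finally show ?thesis .
  qed
  finally show "(LINT Y:weyl p|?\<nu>. G Y) =
      Determinant.det (Matrix.mat p p (\<lambda>(i, j). \<integral>y. g i y * h j y \<partial>lborel))"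
    by (simp add: det_mat_lessThan)
qed

lemma det_mat_scale:
  fixes a :: "nat \<Rightarrow> nat \<Rightarrow> real"
  shows "Determinant.det (Matrix.mat n n (\<lambda>(i, j). c i * a i j * d j)) =
    (\<Prod>i<n. c i) * (\<Prod>j<n. d j) * Determinant.det (Matrix.mat n n (\<lambda>(i, j). a i j))"
proof -
  have "(\<Prod>i<n. c i * a i (\<pi> i) * d (\<pi> i)) =
      (\<Prod>i<n. c i) * (\<Prod>j<n. d j) * (\<Prod>i<n. a i (\<pi> i))" if "\<pi> permutes {..<n}" for \<pi>
    using prod.permute[OF that, of d] by (simp add: prod.distrib o_def mult_ac)
  then show ?thesis
    by (simp add: det_mat_lessThan sum_distrib_left mult_ac)
qed

lemma det_mat_diagonal:
  fixes a :: "nat \<Rightarrow> real"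
  shows "Determinant.det (Matrix.mat n n (\<lambda>(i, j). if i = j then a i else 0)) = (\<Prod>i<n. a i)"
proof -
  have "Determinant.det (Matrix.mat n n (\<lambda>(i, j). if i = j then a i else 0)) =
      prod_list (diag_mat (Matrix.mat n n (\<lambda>(i, j). if i = j then a i else 0)))"
    by (rule det_upper_triangular[where n = n]) (simp_all add: upper_triangular_def)
  then show ?thesis by (simp add: prod_list_diag_prod lessThan_atLeast0)
qed

subsection \<open>Jacobi polynomials\<close>

text \<open>The terminating hypergeometric series as a polynomial in u = 1 - x, the variable in
  which its coefficients are explicit.\<close>

definition jacobi_series :: "nat \<Rightarrow> real \<Rightarrow> real \<Rightarrow> real poly" where
  "jacobi_series k \<alpha> \<beta> = (\<Sum>n\<le>k. Polynomial.monom (pochhammer (\<alpha> + 1) k / fact k *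
     (pochhammer (- real k) n * pochhammer (real k + \<alpha> + \<beta> + 1) n /
       (pochhammer (\<alpha> + 1) n * fact n))) n)"

text \<open>Beyond \<open>k\<close> the Pochhammer symbol of \<open>- real k\<close> is zero, so the
  closed form is valid for all \<open>n\<close> and the recursion below needs no case for the top
  coefficient.\<close>

lemma coeff_jacobi_series:
  "coeff (jacobi_series k \<alpha> \<beta>) n = pochhammer (\<alpha> + 1) k / fact k *
     (pochhammer (- real k) n * pochhammer (real k + \<alpha> + \<beta> + 1) n /
       (pochhammer (\<alpha> + 1) n * fact n))"
proof (cases "n \<le> k")
  case False
  then have "pochhammer (- real k) n = 0" by (intro pochhammer_of_nat_eq_0_lemma) simp
  then show ?thesis using False by (simp add: jacobi_series_def Polynomial.coeff_sum)
qed (simp add: jacobi_series_def Polynomial.coeff_sum)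

lemma degree_jacobi_series: "degree (jacobi_series k \<alpha> \<beta>) \<le> k"
  by (rule degree_le) (simp add: jacobi_series_def Polynomial.coeff_sum)

lemma jacobi_eq_poly: "jacobi k \<alpha> \<beta> x = poly (jacobi_series k \<alpha> \<beta>) (1 - x)"
proof -
  let ?F = "fps_hypergeo [- real k, real k + \<alpha> + \<beta> + 1] [\<alpha> + 1] 1"
  have "fps_nth ?F n = 0" if "n \<notin> {..k}" for n
    using that pochhammer_of_nat_eq_0_lemma[of k n, where 'a = real] by simp
  then have "eval_fps ?F (1 - x) = (\<Sum>n\<le>k. fps_nth ?F n * (1 - x) ^ n)"
    unfolding eval_fps_def by (intro suminf_finite) auto
  then show ?thesis
    by (simp add: jacobi_def jacobi_series_def poly_sum poly_monom sum_distrib_left mult.assoc)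
qed

lemma jacobi_eq_pcompose: "jacobi k \<alpha> \<beta> x = poly (pcompose (jacobi_series k \<alpha> \<beta>) [:1, -1:]) x"
  by (simp add: jacobi_eq_poly poly_pcompose)

lemma pochhammer_add_one_pos: "\<alpha> > -1 \<Longrightarrow> pochhammer (\<alpha> + 1) n > (0::real)"
  by (intro pochhammer_pos) simp

lemma coeff_jacobi_series_Suc:
  assumes "\<alpha> > -1"
  shows "real (Suc n) * (\<alpha> + 1 + real n) * coeff (jacobi_series k \<alpha> \<beta>) (Suc n) =
    (real n - real k) * (real n + real k + \<alpha> + \<beta> + 1) * coeff (jacobi_series k \<alpha> \<beta>) n"
proof -
  have "pochhammer (\<alpha> + 1) n \<noteq> 0" "\<alpha> + 1 + real n \<noteq> 0"
    using pochhammer_add_one_pos[OF assms, of n] assms by auto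
  then show ?thesis
    by (simp add: coeff_jacobi_series pochhammer_Suc divide_simps del: of_nat_Suc)
qed

text \<open>The hypergeometric differential equation with a = -k, b = k + \<alpha> + \<beta> + 1 and
  c = \<alpha> + 1; coefficientwise it is the recursion just proved. For \<alpha> = z' - p and
  \<beta> = w' the number k (k + \<alpha> + \<beta> + 1) is \<open>K_eig\<close>.\<close>

lemma jacobi_series_ode:
  fixes \<alpha> \<beta> u :: real and k :: nat
  assumes "\<alpha> > -1"
  defines "Q \<equiv> jacobi_series k \<alpha> \<beta>"
  shows "u * (1 - u) * poly (pderiv (pderiv Q)) u + (\<alpha> + 1 - (\<alpha> + \<beta> + 2) * u) * poly (pderiv Q) u =
    - (real k * (real k + \<alpha> + \<beta> + 1)) * poly Q u"
proof -
  have "[:0, 1, -1:] * pderiv (pderiv Q) + [:\<alpha> + 1, - (\<alpha> + \<beta> + 2):] * pderiv Q =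
      Polynomial.smult (- (real k * (real k + \<alpha> + \<beta> + 1))) Q"
  proof (rule poly_eqI)
    fix n
    have *: "real (Suc n) * (\<alpha> + 1 + real n) * coeff Q (Suc n) =
        (real n - real k) * (real n + real k + \<alpha> + \<beta> + 1) * coeff Q n"
      unfolding Q_def by (rule coeff_jacobi_series_Suc[OF assms(1)])
    show "coeff ([:0, 1, -1:] * pderiv (pderiv Q) + [:\<alpha> + 1, - (\<alpha> + \<beta> + 2):] * pderiv Q) n =
        coeff (Polynomial.smult (- (real k * (real k + \<alpha> + \<beta> + 1))) Q) n"
    \<comment> \<open>The quadratic and linear factors shift indices by up to two, so the first two
      coefficients are treated separately.\<close>
    proof (cases n)
      case 0
      then show ?thesis using * by (simp add: coeff_pderiv algebra_simps)
    next
      case (Suc m)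
      then show ?thesis
      proof (cases m)
        case 0
        then show ?thesis using * Suc by (simp add: coeff_pderiv algebra_simps)
      next
        case (Suc l)
        then show ?thesis using * \<open>n = Suc m\<close> by (simp add: coeff_pderiv algebra_simps)
      qed
    qed
  qed
  from arg_cong[OF this, of "\<lambda>q. poly q u"] show ?thesis
    by (simp add: algebra_simps)
qed

section \<open>The weight and the orthogonality of the Jacobi polynomials\<close>

definition jacobi_weight :: "real \<Rightarrow> real \<Rightarrow> real \<Rightarrow> real" where
  "jacobi_weight \<alpha> \<beta> x = x powr \<beta> * (1 - x) powr \<alpha>"

lemma jacobi_weight_nonneg: "jacobi_weight \<alpha> \<beta> x \<ge> 0"
  by (simp add: jacobi_weight_def)

lemma integrable_jacobi_weight:
  assumes "\<alpha> > -1" "\<beta> > -1"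
  shows "set_integrable lborel {0..1} (jacobi_weight \<alpha> \<beta>)"
  using integrable_Beta[of "\<beta> + 1" "\<alpha> + 1"] assms by (simp add: jacobi_weight_def[abs_def])

lemma measurable_jacobi_weight [measurable]: "jacobi_weight \<alpha> \<beta> \<in> borel_measurable borel"
  unfolding jacobi_weight_def[abs_def] by measurable

text \<open>The weight may be unbounded at both endpoints. Its integrability comes from the Beta
  integral, and \<open>f\<close> enters only through a bound on the compact interval.\<close>

lemma set_integrable_continuous_mult_weight:
  assumes "\<alpha> > -1" "\<beta> > -1" and f: "continuous_on UNIV f"
  shows "set_integrable lborel {0..1} (\<lambda>x. f x * jacobi_weight \<alpha> \<beta> x)"
proof -
  have "compact (f ` {0..1::real})"
    by (intro compact_continuous_image continuous_on_subset[OF f]) auto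
  then obtain B where B: "\<And>x. x \<in> {0..1} \<Longrightarrow> norm (f x) \<le> B"
    by (meson bounded_iff compact_imp_bounded imageI)
  have [measurable]: "f \<in> borel_measurable borel"
    using f by (rule borel_measurable_continuous_onI)
  have "set_integrable lborel {0..1} (\<lambda>x. B * jacobi_weight \<alpha> \<beta> x)"
    using integrable_jacobi_weight[OF assms(1,2)] by simp
  then show ?thesis
    unfolding set_integrable_def
  proof (rule Bochner_Integration.integrable_bound)
    show "AE x in lborel. norm (indicat_real {0..1} x *\<^sub>R (f x * jacobi_weight \<alpha> \<beta> x)) \<le>
        norm (indicat_real {0..1} x *\<^sub>R (B * jacobi_weight \<alpha> \<beta> x))"
    proof (rule AE_I2)
      fix x :: real
      have "norm (f x * jacobi_weight \<alpha> \<beta> x) \<le> norm (B * jacobi_weight \<alpha> \<beta> x)" if "x \<in> {0..1}"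
        using B[OF that] jacobi_weight_nonneg[of \<alpha> \<beta> x]
        by (simp add: abs_mult mult_right_mono)
      then show "norm (indicat_real {0..1} x *\<^sub>R (f x * jacobi_weight \<alpha> \<beta> x)) \<le>
          norm (indicat_real {0..1} x *\<^sub>R (B * jacobi_weight \<alpha> \<beta> x))"
        by (simp add: indicator_def)
    qed
  qed measurable
qed

lemma continuous_on_jacobi: "continuous_on UNIV (jacobi k \<alpha> \<beta>)"
  unfolding jacobi_eq_poly[abs_def] by (intro continuous_intros)

text \<open>The Sturm-Liouville argument: the two differential equations turn the integrand, up to
  the difference of the eigenvalues, into the derivative of a weighted Wronskian that is zero at
  both endpoints.\<close>

lemma jacobi_orthogonal:
  assumes \<alpha>: "\<alpha> > -1" and \<beta>: "\<beta> > -1" and "k \<noteq> l"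
  shows "(LINT x:{0..1}|lborel. jacobi k \<alpha> \<beta> x * jacobi l \<alpha> \<beta> x * jacobi_weight \<alpha> \<beta> x) = 0"
proof -
  let ?Q = "jacobi_series k \<alpha> \<beta>" and ?R = "jacobi_series l \<alpha> \<beta>"
  let ?f = "\<lambda>x. jacobi k \<alpha> \<beta> x * jacobi l \<alpha> \<beta> x * jacobi_weight \<alpha> \<beta> x"
  define \<kappa> where "\<kappa> = (\<lambda>k. real k * (real k + \<alpha> + \<beta> + 1))"
  define W where "W = (\<lambda>u. poly (pderiv ?Q) u * poly ?R u - poly ?Q u * poly (pderiv ?R) u)"
  \<comment> \<open>Raising both exponents of the weight by one makes them positive, so
    \<open>G\<close> is continuous on the closed interval and vanishes at its ends.\<close>
  define G where "G = (\<lambda>x. x powr (\<beta> + 1) * (1 - x) powr (\<alpha> + 1) * W (1 - x))"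
  have "((\<lambda>x. (\<kappa> k - \<kappa> l) * ?f x) has_integral G 1 - G 0) {0..1}"
  proof (rule fundamental_theorem_of_calculus_interior)
    show "continuous_on {0..1} G"
      unfolding G_def W_def using \<alpha> \<beta>
      by (intro continuous_intros continuous_on_powr') auto
  next
    fix x :: real assume x: "x \<in> {0<..<1}"
    let ?u = "1 - x"
    let ?W' = "poly (pderiv (pderiv ?Q)) ?u * poly ?R ?u - poly ?Q ?u * poly (pderiv (pderiv ?R)) ?u"
    have W: "(W has_real_derivative ?W') (at ?u)"
      unfolding W_def by (auto intro!: derivative_eq_intros simp: algebra_simps)
    have "((\<lambda>x. W (1 - x)) has_real_derivative ?W' * (-1)) (at x)"
      by (rule DERIV_chain2[where g = "\<lambda>x. 1 - x", OF W]) (auto intro!: derivative_eq_intros)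
    then have "(G has_real_derivative
        ((\<beta> + 1) * x powr \<beta> * ?u powr (\<alpha> + 1) - x powr (\<beta> + 1) * ((\<alpha> + 1) * ?u powr \<alpha>)) * W ?u +
        x powr (\<beta> + 1) * ?u powr (\<alpha> + 1) * (?W' * (-1))) (at x)"
      unfolding G_def using x by (auto intro!: derivative_eq_intros simp: algebra_simps)
    also have "((\<beta> + 1) * x powr \<beta> * ?u powr (\<alpha> + 1) - x powr (\<beta> + 1) * ((\<alpha> + 1) * ?u powr \<alpha>)) * W ?u +
        x powr (\<beta> + 1) * ?u powr (\<alpha> + 1) * (?W' * (-1)) =
        - jacobi_weight \<alpha> \<beta> x *
          ((\<alpha> + 1 - (\<alpha> + \<beta> + 2) * ?u) * W ?u + ?u * (1 - ?u) * ?W')"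
      using x by (simp add: jacobi_weight_def powr_add algebra_simps)
    \<comment> \<open>Regrouped so that the hypergeometric operator acts once on \<open>?Q\<close>
      and once on \<open>?R\<close>.\<close>
    also have "(\<alpha> + 1 - (\<alpha> + \<beta> + 2) * ?u) * W ?u + ?u * (1 - ?u) * ?W' =
        (?u * (1 - ?u) * poly (pderiv (pderiv ?Q)) ?u +
          (\<alpha> + 1 - (\<alpha> + \<beta> + 2) * ?u) * poly (pderiv ?Q) ?u) * poly ?R ?u -
        poly ?Q ?u * (?u * (1 - ?u) * poly (pderiv (pderiv ?R)) ?u +
          (\<alpha> + 1 - (\<alpha> + \<beta> + 2) * ?u) * poly (pderiv ?R) ?u)"
      by (simp only: W_def) (simp only: algebra_simps)
    also have "\<dots> = (\<kappa> l - \<kappa> k) * (poly ?Q ?u * poly ?R ?u)"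
      unfolding jacobi_series_ode[OF \<alpha>] \<kappa>_def by (simp add: algebra_simps)
    finally show "(G has_vector_derivative (\<kappa> k - \<kappa> l) * ?f x) (at x)"
      by (simp add: has_real_derivative_iff_has_vector_derivative jacobi_eq_poly algebra_simps)
  qed simp
  then have int: "((\<lambda>x. (\<kappa> k - \<kappa> l) * ?f x) has_integral 0) {0..1}"
    using \<alpha> \<beta> by (simp add: G_def)
  \<comment> \<open>The difference factors as (k - l)(k + l + \<alpha> + \<beta> + 1), where the
    second factor is positive because k + l is at least 1 and \<alpha> + \<beta> exceeds -2.\<close>
  have "\<kappa> k \<noteq> \<kappa> l"
  proof
    assume "\<kappa> k = \<kappa> l"
    then have "(real k - real l) * (real k + real l + \<alpha> + \<beta> + 1) = 0"
      by (simp add: \<kappa>_def algebra_simps)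
    moreover have "real k + real l \<ge> 1" using \<open>k \<noteq> l\<close> by linarith
    ultimately show False using \<open>k \<noteq> l\<close> \<alpha> \<beta> by auto
  qed
  have "set_integrable lborel {0..1} ?f"
    using set_integrable_continuous_mult_weight[OF \<alpha> \<beta>,
        of "\<lambda>x. jacobi k \<alpha> \<beta> x * jacobi l \<alpha> \<beta> x"]
    by (simp add: continuous_on_mult continuous_on_jacobi)
  then have "set_integrable lborel {0..1} (\<lambda>x. (\<kappa> k - \<kappa> l) * ?f x)" by simp
  then have "(LINT x:{0..1}|lborel. (\<kappa> k - \<kappa> l) * ?f x) = 0"
    using set_borel_integral_eq_integral(2) integral_unique[OF int] by metis
  then show ?thesis using \<open>\<kappa> k \<noteq> \<kappa> l\<close> by simp
qed

subsection \<open>Growth of the normalized Jacobi polynomials\<close>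

lemma abs_pochhammer_le:
  fixes a B :: real
  assumes "\<And>i. i < n \<Longrightarrow> \<bar>a + real i\<bar> \<le> B"
  shows "\<bar>pochhammer a n\<bar> \<le> B ^ n"
proof -
  have "\<bar>pochhammer a n\<bar> = (\<Prod>i=0..<n. \<bar>a + real i\<bar>)"
    by (simp add: pochhammer_prod abs_prod)
  also have "\<dots> \<le> (\<Prod>i=0..<n. B)"
    using assms by (intro prod_mono) auto
  finally show ?thesis by simp
qed

text \<open>With c the minimum, every factor \<alpha> + 1 + n is at least (n + 1) c. This bounds
  both the reciprocals in the coefficients and the value of the polynomial at x = 1.\<close>

lemma pochhammer_ge_power:
  fixes \<alpha> :: real
  assumes "\<alpha> > -1"
  shows "fact n * min 1 (\<alpha> + 1) ^ n \<le> pochhammer (\<alpha> + 1) n"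
proof -
  define c where "c = min 1 (\<alpha> + 1)"
  have c: "0 < c" "c \<le> 1" "c \<le> \<alpha> + 1" using assms by (auto simp: c_def)
  have "fact n * c ^ n \<le> pochhammer (\<alpha> + 1) n"
  proof (induction n)
    case (Suc n)
  have "real (Suc n) * c \<le> \<alpha> + 1 + real n"
  proof -
    have "real n * c \<le> real n" using c mult_left_le[of c "real n"] by simp
    then show ?thesis using c by (simp add: distrib_right)
  qed
  then have "(fact n * c ^ n) * (real (Suc n) * c) \<le> pochhammer (\<alpha> + 1) n * (\<alpha> + 1 + real n)"
    using Suc c pochhammer_add_one_pos[OF assms, of n] by (intro mult_mono) auto
  then show ?case by (simp add: pochhammer_Suc algebra_simps)
  qed simp
  then show ?thesis by (simp add: c_def)
qed

lemma powr_ge_power: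
  fixes a x r :: real
  assumes "\<bar>a\<bar> \<le> real b" "0 < r" "r \<le> x" "x \<le> 1"
  shows "r ^ b \<le> x powr a"
proof -
  have "r ^ b \<le> x ^ b" using assms by (intro power_mono) auto
  also have "\<dots> = x powr real b" using assms by (simp add: powr_realpow)
  also have "\<dots> \<le> x powr a" using assms by (intro powr_mono') auto
  finally show ?thesis .
qed

text \<open>The crude bounds \<open>E\<^bsup>O(k)\<^esup>\<close> with \<open>E = A (k + 1)\<close> are enough, as the
  series defining the transition density has the Gaussian factor \<open>exp (- t k\<^sup>2)\<close>.\<close>

definition jacobi_scale :: "real \<Rightarrow> real \<Rightarrow> real" where
  "jacobi_scale \<alpha> \<beta> = 2 + \<bar>\<alpha>\<bar> + \<bar>\<beta>\<bar> + 1 / min 1 (\<alpha> + 1)"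

context
  fixes \<alpha> \<beta> :: real and k :: nat and E :: real
  assumes \<alpha>: "\<alpha> > -1" and \<beta>: "\<beta> > -1"
  defines "E \<equiv> jacobi_scale \<alpha> \<beta> * real (k + 1)"
begin

text \<open>\<open>E\<close> is chosen to dominate at once all factors of the Pochhammer symbols,
  the number of coefficients and the loss from \<open>pochhammer_ge_power\<close>.\<close>

lemma scale_bounds:
  "2 \<le> E" "real k + 1 \<le> E" "\<bar>\<alpha>\<bar> + 1 + real k \<le> E" "2 * real k + \<bar>\<alpha>\<bar> + \<bar>\<beta>\<bar> + 1 \<le> E"
  "1 / min 1 (\<alpha> + 1) \<le> E"
proof -
  let ?A = "jacobi_scale \<alpha> \<beta>"
  have c: "1 / min 1 (\<alpha> + 1) > 0" using \<alpha> by simp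
  have "?A * real k + ?A = E" by (simp add: E_def algebra_simps)
  moreover have "2 * real k \<le> ?A * real k"
    using c by (intro mult_right_mono) (auto simp: jacobi_scale_def)
  moreover have "?A \<ge> 2 + \<bar>\<alpha>\<bar> + \<bar>\<beta>\<bar>" "1 / min 1 (\<alpha> + 1) \<le> ?A" using c by (auto simp: jacobi_scale_def)
  ultimately show "2 \<le> E" "real k + 1 \<le> E" "\<bar>\<alpha>\<bar> + 1 + real k \<le> E"
      "2 * real k + \<bar>\<alpha>\<bar> + \<bar>\<beta>\<bar> + 1 \<le> E" "1 / min 1 (\<alpha> + 1) \<le> E"
    by linarith+
qed

text \<open>The exponent 4k counts four factors, each at most \<open>E ^ k\<close>: the
  normalization, the two Pochhammer symbols in the numerator, and the reciprocal of the
  denominator.\<close>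

lemma abs_coeff_jacobi_series_le: "\<bar>coeff (jacobi_series k \<alpha> \<beta>) n\<bar> \<le> E ^ (4 * k)"
proof (cases "n \<le> k")
  case False
  then have "coeff (jacobi_series k \<alpha> \<beta>) n = 0"
    using degree_jacobi_series[of k \<alpha> \<beta>] by (intro coeff_eq_0) simp
  then show ?thesis using scale_bounds(1) by simp
next
  case True
  let ?c = "min 1 (\<alpha> + 1)"
  have E1: "1 \<le> E" "0 \<le> E" using scale_bounds(1) by auto
  have le_k: "E ^ n \<le> E ^ k" using True E1 by (intro power_increasing) auto
  have "\<bar>pochhammer (\<alpha> + 1) k\<bar> \<le> E ^ k"
    using scale_bounds(3) by (intro abs_pochhammer_le) linarith
  moreover have "\<bar>pochhammer (\<alpha> + 1) k\<bar> / fact k \<le> \<bar>pochhammer (\<alpha> + 1) k\<bar> / 1"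
    by (intro divide_left_mono) (auto simp: fact_ge_1)
  ultimately have 1: "\<bar>pochhammer (\<alpha> + 1) k / fact k\<bar> \<le> E ^ k"
    by (simp add: abs_divide)
  have 2: "\<bar>pochhammer (- real k) n\<bar> \<le> E ^ k"
  proof (rule order.trans[OF abs_pochhammer_le le_k])
    fix i assume "i < n"
    then have "real i < real k" using True by simp
    then show "\<bar>- real k + real i\<bar> \<le> E" using scale_bounds(2) by linarith
  qed
  have 3: "\<bar>pochhammer (real k + \<alpha> + \<beta> + 1) n\<bar> \<le> E ^ k"
  proof (rule order.trans[OF abs_pochhammer_le le_k])
    fix i assume "i < n"
    then have "real i < real k" using True by simp
    then show "\<bar>real k + \<alpha> + \<beta> + 1 + real i\<bar> \<le> E" using scale_bounds(4) by linarith
  qed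
  have 4: "\<bar>1 / (pochhammer (\<alpha> + 1) n * fact n)\<bar> \<le> E ^ k"
  proof -
    have c: "0 < ?c" using \<alpha> by simp
    have "?c ^ n \<le> fact n * ?c ^ n" using c by (simp add: fact_ge_1)
    also have "\<dots> \<le> pochhammer (\<alpha> + 1) n" by (rule pochhammer_ge_power[OF \<alpha>])
    also have "\<dots> \<le> pochhammer (\<alpha> + 1) n * fact n"
      using pochhammer_add_one_pos[OF \<alpha>, of n] by (simp add: fact_ge_1)
    finally have ge: "?c ^ n \<le> pochhammer (\<alpha> + 1) n * fact n" .
    have "\<bar>1 / (pochhammer (\<alpha> + 1) n * fact n)\<bar> = 1 / (pochhammer (\<alpha> + 1) n * fact n)"
      using pochhammer_add_one_pos[OF \<alpha>, of n] by simp
    also have "\<dots> \<le> 1 / ?c ^ n"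
      using ge zero_less_power[OF c, of n] by (intro divide_left_mono) (auto intro!: mult_pos_pos)
    also have "\<dots> = (1 / ?c) ^ n" by (simp add: power_divide)
    also have "\<dots> \<le> E ^ n" using scale_bounds(5) c by (intro power_mono) auto
    also note le_k
    finally show ?thesis .
  qed
  have "\<bar>coeff (jacobi_series k \<alpha> \<beta>) n\<bar> =
      \<bar>pochhammer (\<alpha> + 1) k / fact k\<bar> * (\<bar>pochhammer (- real k) n\<bar> *
        \<bar>pochhammer (real k + \<alpha> + \<beta> + 1) n\<bar> * \<bar>1 / (pochhammer (\<alpha> + 1) n * fact n)\<bar>)"
    by (simp add: coeff_jacobi_series abs_mult)
  also have "\<dots> \<le> E ^ k * (E ^ k * E ^ k * E ^ k)"
    using E1 by (intro mult_mono 1 2 3 4) auto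
  also have "\<dots> = E ^ (4 * k)"
    by (simp only: power_add[symmetric]) (rule arg_cong[where f = "(^) E"], simp)
  finally show ?thesis .
qed

text \<open>Summing k + 1 coefficients costs one more power of \<open>E\<close>, and differentiation
  costs another.\<close>

lemma abs_poly_jacobi_series_le:
  assumes "u \<in> {0..1}"
  shows "\<bar>poly (jacobi_series k \<alpha> \<beta>) u\<bar> \<le> E ^ (4 * k + 1)"
    and "\<bar>poly (pderiv (jacobi_series k \<alpha> \<beta>)) u\<bar> \<le> E ^ (4 * k + 2)"
proof -
  let ?Q = "jacobi_series k \<alpha> \<beta>"
  have E1: "1 \<le> E" "0 \<le> E" using scale_bounds(1) by auto
  have u: "\<bar>u ^ n\<bar> \<le> 1" for n using assms by (simp add: power_abs power_le_one)
  have eval: "poly q u = (\<Sum>n\<le>k. coeff q n * u ^ n)" if "degree q \<le> k" for q :: "real poly"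
    unfolding poly_altdef using that
    by (intro sum.mono_neutral_left) (auto simp: coeff_eq_0)
  have bound: "\<bar>poly q u\<bar> \<le> E * C"
    if "degree q \<le> k" "\<And>n. n \<le> k \<Longrightarrow> \<bar>coeff q n\<bar> \<le> C" for q :: "real poly" and C
  proof -
    have C: "0 \<le> C" using that(2)[of 0] by simp
    have "\<bar>poly q u\<bar> \<le> (\<Sum>n\<le>k. \<bar>coeff q n * u ^ n\<bar>)"
      unfolding eval[OF that(1)] by (rule sum_abs)
    also have "\<dots> \<le> (\<Sum>n\<le>k. C)"
    proof (rule sum_mono)
      fix n assume "n \<in> {..k}"
      then have "\<bar>coeff q n\<bar> * \<bar>u ^ n\<bar> \<le> C * 1"
        using that(2)[of n] u C by (intro mult_mono) auto
      then show "\<bar>coeff q n * u ^ n\<bar> \<le> C" by (simp add: abs_mult)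
    qed
    also have "\<dots> = (real k + 1) * C" by simp
    also have "\<dots> \<le> E * C" using scale_bounds(2) C by (intro mult_right_mono) auto
    finally show ?thesis .
  qed
  show "\<bar>poly ?Q u\<bar> \<le> E ^ (4 * k + 1)"
    using bound[OF degree_jacobi_series abs_coeff_jacobi_series_le] by simp
  have "\<bar>poly (pderiv ?Q) u\<bar> \<le> E * (E * E ^ (4 * k))"
  proof (rule bound)
    show "degree (pderiv ?Q) \<le> k" using degree_jacobi_series[of k \<alpha> \<beta>] by (simp add: degree_pderiv)
    fix n assume "n \<le> k"
    have "real (Suc n) * \<bar>coeff ?Q (Suc n)\<bar> \<le> E * E ^ (4 * k)"
      using \<open>n \<le> k\<close> scale_bounds(2) E1 by (intro mult_mono abs_coeff_jacobi_series_le) auto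
    then show "\<bar>coeff (pderiv ?Q) n\<bar> \<le> E * E ^ (4 * k)"
      by (simp add: coeff_pderiv abs_mult del: of_nat_Suc)
  qed
  then show "\<bar>poly (pderiv ?Q) u\<bar> \<le> E ^ (4 * k + 2)" by simp
qed

text \<open>\<open>jacobi k \<alpha> \<beta> 1\<close> is at least \<open>E\<^bsup>-k\<^esup>\<close>, and the derivative bound keeps the polynomial
  above half of that on an interval of length \<open>E\<^bsup>-O(k)\<^esup>\<close> at \<open>1\<close>.\<close>

lemma abs_poly_jacobi_series_ge:
  assumes u: "0 \<le> u" "u \<le> (1 / E) ^ (5 * k + 3)"
  shows "(1 / E) ^ (k + 1) \<le> \<bar>poly (jacobi_series k \<alpha> \<beta>) u\<bar>"
proof -
  let ?Q = "jacobi_series k \<alpha> \<beta>" and ?c = "min 1 (\<alpha> + 1)"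
  have E: "2 \<le> E" "0 < E" using scale_bounds(1) by auto
  have "(1 / E) ^ (5 * k + 3) \<le> 1" using E by (intro power_le_one) auto
  then have u1: "u \<le> 1" using u by linarith
  have c: "0 < ?c" using \<alpha> by simp
  have "1 / E \<le> d" if "1 / d \<le> E" "0 < d" for d
    using that E by (simp add: field_simps)
  from this[OF scale_bounds(5) c] have "(1 / E) ^ k \<le> ?c ^ k"
    by (rule power_mono) (use E in simp)
  also have "\<dots> \<le> pochhammer (\<alpha> + 1) k / fact k"
    using pochhammer_ge_power[OF \<alpha>, of k] by (simp add: field_simps)
  also have "\<dots> = poly ?Q 0"
    by (simp add: poly_0_coeff_0 coeff_jacobi_series)
  finally have v: "(1 / E) ^ k \<le> poly ?Q 0" .
  have "\<bar>poly ?Q u - poly ?Q 0\<bar> \<le> E ^ (4 * k + 2) * u"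
  proof -
    have "norm (poly ?Q u - poly ?Q 0) \<le> E ^ (4 * k + 2) * norm (u - 0)"
    proof (rule field_differentiable_bound[of "{0..1}"])
      fix z :: real assume "z \<in> {0..1}"
      then show "norm (poly (pderiv ?Q) z) \<le> E ^ (4 * k + 2)"
        using abs_poly_jacobi_series_le(2) by simp
      show "(poly ?Q has_field_derivative poly (pderiv ?Q) z) (at z within {0..1})"
        by (rule has_field_derivative_at_within) (rule poly_DERIV)
    qed (use u u1 in auto)
    then show ?thesis using u by simp
  qed
  \<comment> \<open>Here 5k + 3 = (4k + 2) + (k + 1): the derivative bound times the length of the
    interval leaves \<open>(1 / E) ^ (k + 1)\<close>, at most half of the lower bound for the value
    at \<open>u = 0\<close>.\<close>
  also have "\<dots> \<le> E ^ (4 * k + 2) * (1 / E) ^ (5 * k + 3)"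
    using u E by (intro mult_left_mono) auto
  also have "\<dots> = (1 / E) ^ (k + 1)"
  proof -
    have "E ^ (4 * k + 2) * (1 / E) ^ (4 * k + 2) = 1"
      using E by (simp add: power_mult_distrib[symmetric] del: power_Suc)
    moreover have "(1 / E) ^ (5 * k + 3) = (1 / E) ^ (4 * k + 2) * (1 / E) ^ (k + 1)"
      unfolding power_add[symmetric] by (rule arg_cong[where f = "(^) (1 / E)"]) simp
    ultimately show ?thesis by (simp only: mult.assoc[symmetric] mult_1)
  qed
  finally have diff: "\<bar>poly ?Q u - poly ?Q 0\<bar> \<le> (1 / E) ^ (k + 1)" .
  have half: "2 * (1 / E) ^ (k + 1) \<le> (1 / E) ^ k"
  proof -
    have "(2 / E) * (1 / E) ^ k \<le> 1 * (1 / E) ^ k" using E by (intro mult_right_mono) auto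
    then show ?thesis by simp
  qed
  have "d \<le> \<bar>a\<bar>" if "\<bar>a - b\<bar> \<le> d" "2 * d \<le> e" "e \<le> b" for a b d e :: real
    using that by linarith
  from this[OF diff half v] show ?thesis .
qed

text \<open>Only the part of the integral over [1 - \<delta>, 1 - \<delta>/2] is kept. There the
  polynomial is not small, and the distance to both endpoints keeps the weight away from
  zero.\<close>

lemma jacobi_norm_ge:
  assumes b: "\<bar>\<alpha>\<bar> \<le> real b" "\<bar>\<beta>\<bar> \<le> real b"
  shows "(1 / E) ^ ((6 * b + 7) * (k + 1)) \<le>
    (LINT x:{0..1}|lborel. jacobi k \<alpha> \<beta> x * jacobi k \<alpha> \<beta> x * jacobi_weight \<alpha> \<beta> x)"
proof -
  let ?r = "1 / E"
  define \<delta> where "\<delta> = ?r ^ (5 * k + 3)"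
  \<comment> \<open>A lower bound for the integrand on that interval: the squared polynomial, then
    the powers of x and of 1 - x.\<close>
  define c where "c = (?r ^ (k + 1))\<^sup>2 * (?r ^ b * (\<delta> / 2) ^ b)"
  let ?f = "\<lambda>x. jacobi k \<alpha> \<beta> x * jacobi k \<alpha> \<beta> x * jacobi_weight \<alpha> \<beta> x"
  have r: "0 < ?r" "?r \<le> 1/2" using scale_bounds(1) by auto
  have \<delta>: "0 < \<delta>" "\<delta> \<le> 1/2"
  proof -
    show "0 < \<delta>" using r by (simp add: \<delta>_def)
    have "?r ^ (5 * k + 3) \<le> ?r ^ 1" using r by (intro power_decreasing) auto
    then show "\<delta> \<le> 1/2" unfolding \<delta>_def power_one_right using r(2) by (rule order.trans)
  qed
  have c: "0 \<le> c" using \<delta> r by (simp add: c_def)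
  have int: "set_integrable lborel {0..1} ?f"
    using set_integrable_continuous_mult_weight[OF \<alpha> \<beta>,
        of "\<lambda>x. jacobi k \<alpha> \<beta> x * jacobi k \<alpha> \<beta> x"]
    by (simp add: continuous_on_mult continuous_on_jacobi)
  have f_ge: "indicator {1 - \<delta>..1 - \<delta> / 2} x *\<^sub>R c \<le> indicator {0..1} x *\<^sub>R ?f x" for x :: real
  proof (cases "x \<in> {1 - \<delta>..1 - \<delta> / 2}")
    case True
    then have x: "\<delta> / 2 \<le> 1 - x" "1 - x \<le> \<delta>" "1/2 \<le> x" "x \<le> 1" "0 \<le> 1 - x" using \<delta> by auto
    have rx: "?r \<le> x" using x(3) r(2) by linarith
    have "(?r ^ (k + 1))\<^sup>2 \<le> \<bar>poly (jacobi_series k \<alpha> \<beta>) (1 - x)\<bar>\<^sup>2"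
    proof (rule power_mono)
      show "?r ^ (k + 1) \<le> \<bar>poly (jacobi_series k \<alpha> \<beta>) (1 - x)\<bar>"
        by (rule abs_poly_jacobi_series_ge) (use x in \<open>simp_all add: \<delta>_def\<close>)
    qed (use r in simp)
    moreover have "?r ^ b * (\<delta> / 2) ^ b \<le> jacobi_weight \<alpha> \<beta> x"
      unfolding jacobi_weight_def
    proof (rule mult_mono)
      show "?r ^ b \<le> x powr \<beta>" by (rule powr_ge_power[OF b(2) r(1) rx x(4)])
      show "(\<delta> / 2) ^ b \<le> (1 - x) powr \<alpha>"
        by (rule powr_ge_power[OF b(1) _ x(1)]) (use x \<delta> in simp_all)
    qed (use \<delta> in simp_all)
    ultimately have "c \<le> \<bar>poly (jacobi_series k \<alpha> \<beta>) (1 - x)\<bar>\<^sup>2 * jacobi_weight \<alpha> \<beta> x"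
      unfolding c_def by (rule mult_mono) (use r \<delta> in simp_all)
    then have "c \<le> ?f x" by (simp add: jacobi_eq_poly power2_eq_square mult.assoc)
    then show ?thesis using True x by simp
  next
    case False
    have "0 \<le> indicator {0..1} x *\<^sub>R ?f x"
      by (intro scaleR_nonneg_nonneg mult_nonneg_nonneg jacobi_weight_nonneg zero_le_square) simp
    then show ?thesis by (simp only: indicator_simps(2)[OF False] scaleR_zero_left)
  qed
  have exps: "?r ^ (5 * k + 4) \<le> \<delta> / 2"
  proof -
    have "5 * k + 4 = Suc (5 * k + 3)" by simp
    then have "?r ^ (5 * k + 4) = ?r * \<delta>" by (simp only: \<delta>_def power_Suc)
    also have "\<dots> \<le> 1/2 * \<delta>" using r \<delta> by (intro mult_right_mono) auto
    finally show ?thesis by simp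
  qed
  \<comment> \<open>The summands of the exponent come from the squared polynomial, the power of x,
    the power of 1 - x and the length \<delta>/2.\<close>
  have "?r ^ ((6 * b + 7) * (k + 1)) \<le> ?r ^ ((2 * k + 2) + b + (5 * k + 4) * b + (5 * k + 4))"
    using r by (intro power_decreasing) (auto simp: algebra_simps)
  also have "\<dots> = (?r ^ (k + 1))\<^sup>2 * (?r ^ b * (?r ^ (5 * k + 4)) ^ b) * ?r ^ (5 * k + 4)"
    by (simp only: power_add[symmetric] power_mult[symmetric] mult.assoc)
      (rule arg_cong[where f = "(^) (1 / E)"], simp)
  also have "\<dots> \<le> (?r ^ (k + 1))\<^sup>2 * (?r ^ b * (\<delta> / 2) ^ b) * (\<delta> / 2)"
  proof (rule mult_mono[OF mult_left_mono[OF mult_left_mono[OF power_mono[OF exps]]] exps])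
  qed (use r \<delta> in simp_all)
  finally have ge: "?r ^ ((6 * b + 7) * (k + 1)) \<le> c * (\<delta> / 2)"
    unfolding c_def .
  have eq: "c * (\<delta> / 2) = (\<integral>x. indicator {1 - \<delta>..1 - \<delta> / 2} x *\<^sub>R c \<partial>lborel)"
    using \<delta> by simp
  have le: "(\<integral>x. indicator {1 - \<delta>..1 - \<delta> / 2} x *\<^sub>R c \<partial>lborel) \<le>
      (LINT x:{0..1}|lborel. ?f x)"
    unfolding set_lebesgue_integral_def
  proof (rule Bochner_Integration.integral_mono)
    show "integrable lborel (\<lambda>x. indicator {1 - \<delta>..1 - \<delta> / 2} x *\<^sub>R c)"
      by (intro integrable_scaleR_left)
        (simp add: integrable_indicator_iff emeasure_lborel_Icc_eq)
    show "integrable lborel (\<lambda>x. indicator {0..1} x *\<^sub>R ?f x)"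
      using int unfolding set_integrable_def .
    fix x :: real
    show "indicator {1 - \<delta>..1 - \<delta> / 2} x *\<^sub>R c \<le> indicator {0..1} x *\<^sub>R ?f x"
      by (fact f_ge)
  qed
  show ?thesis
    by (rule order.trans[OF ge[unfolded eq] le])
qed

end

text \<open>The second factor is exp(O(k log k)), so the quadratic exponent wins. The extra summand
  \<open>real k\<close> in the asymptotic estimate leaves a geometric majorant.\<close>

lemma summable_gaussian_superexponential:
  fixes A s t :: real and M :: nat
  assumes "A > 0" "t > 0"
  shows "summable (\<lambda>k. exp (- t * (real k * (real k + s))) * (A * real (k + 1)) ^ (M * (k + 1)))"
proof (rule summable_comparison_test_ev)
  have "eventually (\<lambda>k::nat. - t * (real k * (real k + s)) +
      real M * (real k + 1) * ln (A * (real k + 1)) + real k \<le> 0) at_top"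
    using assms by real_asymp
  then show "\<forall>\<^sub>F k in sequentially. norm (exp (- t * (real k * (real k + s))) *
      (A * real (k + 1)) ^ (M * (k + 1))) \<le> exp (-1) ^ k"
  proof eventually_elim
    case (elim k)
    have "(A * real (k + 1)) ^ (M * (k + 1)) =
        exp (real M * (real k + 1) * ln (A * (real k + 1)))"
    proof -
      have "A * real (k + 1) = exp (ln (A * (real k + 1)))"
        using assms by (subst exp_ln) (simp_all add: add.commute)
      then have "(A * real (k + 1)) ^ (M * (k + 1)) =
          exp (real (M * (k + 1)) * ln (A * (real k + 1)))"
        by (simp only: exp_of_nat_mult)
      then show ?thesis by (simp add: algebra_simps)
    qed
    then have "exp (- t * (real k * (real k + s))) * (A * real (k + 1)) ^ (M * (k + 1)) =
        exp (- t * (real k * (real k + s)) + real M * (real k + 1) * ln (A * (real k + 1)))"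
      by (simp only: exp_add)
    also have "\<dots> \<le> exp (- real k)" using elim by simp
    also have "\<dots> = exp (-1) ^ k" by (simp add: exp_of_nat_mult[symmetric])
    finally show ?case using assms by simp
  qed
qed (simp add: summable_geometric)

subsection \<open>The eigenvalue equation\<close>

locale jacobi_parameters =
  fixes p :: nat and z' w' :: real
  assumes z': "z' > real p - 1" and w': "w' > -1"
begin

abbreviation (input) "\<alpha> \<equiv> z' - real p"
abbreviation (input) "J \<equiv> \<lambda>k. jacobi k (z' - real p) w'"
abbreviation (input) "w \<equiv> jac_weight p z' w'"
abbreviation (input) "nrm \<equiv> \<lambda>k. jac_inner p z' w' (J k) (J k)"

lemma \<alpha>_gt: "\<alpha> > -1"
  using z' by simp

lemma jac_weight_eq: "w = jacobi_weight \<alpha> w'"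
  by (rule ext) (simp add: jac_weight_def jacobi_weight_def)

lemma jac_weight_nonneg: "0 \<le> w x"
  by (simp add: jac_weight_eq jacobi_weight_nonneg)

lemma set_integrable_jacobi_mult:
  "set_integrable lborel {0..1} (\<lambda>x. J k x * J l x * w x)"
  unfolding jac_weight_eq
  by (intro set_integrable_continuous_mult_weight \<alpha>_gt w' continuous_on_mult continuous_on_jacobi)

lemma jac_inner_jacobi: "k \<noteq> l \<Longrightarrow> jac_inner p z' w' (J k) (J l) = 0"
  unfolding jac_inner_def jac_weight_eq by (rule jacobi_orthogonal[OF \<alpha>_gt w'])

lemma jacobi_scale_ge: "2 \<le> jacobi_scale \<alpha> w'"
  using scale_bounds(1)[OF \<alpha>_gt w', of 0] by simp

text \<open>Combines the upper bounds at \<open>x\<close> and \<open>y\<close> with the lower bound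
  on the norm; positivity of the norm is a by-product of the latter.\<close>

lemma jacobi_product_bound:
  obtains M where "\<And>k. 0 < nrm k"
    and "\<And>k x y. x \<in> {0..1} \<Longrightarrow> y \<in> {0..1} \<Longrightarrow>
      \<bar>J k x * J k y / nrm k\<bar> \<le> (jacobi_scale \<alpha> w' * real (k + 1)) ^ (M * (k + 1))"
proof -
  define b where "b = nat \<lceil>\<bar>\<alpha>\<bar> + \<bar>w'\<bar>\<rceil>"
  have b: "\<bar>\<alpha>\<bar> \<le> real b" "\<bar>w'\<bar> \<le> real b" unfolding b_def by linarith+
  let ?E = "\<lambda>k. jacobi_scale \<alpha> w' * real (k + 1)"
  have E: "2 \<le> ?E k" for k by (rule scale_bounds(1)[OF \<alpha>_gt w'])
  have ge: "(1 / ?E k) ^ ((6 * b + 7) * (k + 1)) \<le> nrm k" for k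
    unfolding jac_inner_def jac_weight_eq by (rule jacobi_norm_ge[OF \<alpha>_gt w' b])
  have pos: "0 < (1 / ?E k) ^ ((6 * b + 7) * (k + 1))" for k
    using E[of k] by (intro zero_less_power) simp
  have nrm_pos: "0 < nrm k" for k using ge[of k] pos[of k] by linarith
  have "\<bar>J k x * J k y / nrm k\<bar> \<le> ?E k ^ ((6 * b + 15) * (k + 1))"
    if x: "x \<in> {0..1}" and y: "y \<in> {0..1}" for k x y
  proof -
    have le: "\<bar>J k x\<bar> \<le> ?E k ^ (4 * k + 1)" if "x \<in> {0..1}" for x
      unfolding jacobi_eq_poly
      by (rule abs_poly_jacobi_series_le(1)[OF \<alpha>_gt w']) (use that in simp)
    have "1 / nrm k \<le> 1 / (1 / ?E k) ^ ((6 * b + 7) * (k + 1))"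
      using ge[of k] pos[of k] nrm_pos[of k] by (intro divide_left_mono) simp_all
    also have "\<dots> = ?E k ^ ((6 * b + 7) * (k + 1))"
      by (simp only: power_one_over divide_divide_eq_right mult_1 div_by_1)
    finally have inv: "1 / nrm k \<le> ?E k ^ ((6 * b + 7) * (k + 1))" .
    have "\<bar>J k x * J k y / nrm k\<bar> = \<bar>J k x\<bar> * \<bar>J k y\<bar> * (1 / nrm k)"
      using nrm_pos[of k] by (simp add: abs_mult abs_divide)
    also have "\<dots> \<le> ?E k ^ (4 * k + 1) * ?E k ^ (4 * k + 1) * ?E k ^ ((6 * b + 7) * (k + 1))"
    proof (rule mult_mono[OF mult_mono[OF le[OF x] le[OF y]] inv])
      show "0 \<le> 1 / nrm k" using nrm_pos[of k] by simp
    qed (use E[of k] in simp_all)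
    also have "\<dots> = ?E k ^ ((4 * k + 1) + (4 * k + 1) + (6 * b + 7) * (k + 1))"
      by (simp only: power_add)
    \<comment> \<open>The two polynomial bounds together contribute at most 8 (k + 1), which raises
      6b + 7 to 6b + 15.\<close>
    also have "\<dots> \<le> ?E k ^ ((6 * b + 15) * (k + 1))"
    proof (rule power_increasing)
      show "1 \<le> ?E k" using E[of k] by linarith
    qed (simp add: algebra_simps)
    finally show ?thesis .
  qed
  with nrm_pos show ?thesis by (rule that)
qed

lemma nrm_pos: "0 < nrm k"
  by (rule jacobi_product_bound) blast

text \<open>The indicator supplies the support condition of \<open>andreief_weyl\<close>. Unlike
  \<open>jac_fun\<close>, this is not normalized, so that determinants of it match the
  multi-dimensional polynomial.\<close>

definition weighted_jacobi :: "nat \<Rightarrow> real \<Rightarrow> real" where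
  "weighted_jacobi l y = indicator {0..1} y * (J l y * sqrt (w y))"

lemma
  shows integrable_weighted_jacobi_mult: "integrable lborel (\<lambda>y. weighted_jacobi k y * weighted_jacobi l y)"
    and integral_weighted_jacobi_mult: "(\<integral>y. weighted_jacobi k y * weighted_jacobi l y \<partial>lborel) = (if k = l then nrm k else 0)"
proof -
  have eq: "weighted_jacobi k y * weighted_jacobi l y = indicator {0..1} y *\<^sub>R (J k y * J l y * w y)" for y
  proof -
    have "sqrt (w y) * sqrt (w y) = w y" by (simp add: jac_weight_nonneg)
    then show ?thesis unfolding weighted_jacobi_def by (simp add: indicator_def mult_ac)
  qed
  show "integrable lborel (\<lambda>y. weighted_jacobi k y * weighted_jacobi l y)"
    unfolding eq using set_integrable_jacobi_mult[of k l] by (simp only: set_integrable_def)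
  have "(\<integral>y. weighted_jacobi k y * weighted_jacobi l y \<partial>lborel) = jac_inner p z' w' (J k) (J l)"
    unfolding eq jac_inner_def set_lebesgue_integral_def ..
  then show "(\<integral>y. weighted_jacobi k y * weighted_jacobi l y \<partial>lborel) = (if k = l then nrm k else 0)"
    using jac_inner_jacobi[of k l] by simp
qed

section \<open>The one-particle kernel and its eigenfunctions\<close>

context
  fixes t :: real
  assumes t: "t > 0"
begin

definition kernel :: "real \<Rightarrow> real \<Rightarrow> real" where
  "kernel x y = (\<Sum>k. exp (- t * K_eig p z' w' k) * jac_fun p z' w' k x * jac_fun p z' w' k y)"

lemma kernel_term:
  "exp (- t * K_eig p z' w' k) * jac_fun p z' w' k x * jac_fun p z' w' k y =
    exp (- t * K_eig p z' w' k) * (J k x * J k y / nrm k) * (sqrt (w x) * sqrt (w y))"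
proof -
  have "sqrt (nrm k) * sqrt (nrm k) = nrm k" using nrm_pos[of k] by simp
  then show ?thesis by (simp add: jac_fun_def)
qed

text \<open>The majorant separates the summation index from the points. It therefore serves both
  pointwise convergence of the series and its summation under the integral.\<close>

lemma kernel_term_bound:
  obtains a where "summable a" and "\<And>k. 0 \<le> a k"
    and "\<And>k x y. x \<in> {0..1} \<Longrightarrow> y \<in> {0..1} \<Longrightarrow>
      \<bar>exp (- t * K_eig p z' w' k) * jac_fun p z' w' k x * jac_fun p z' w' k y\<bar> \<le>
      a k * (sqrt (w x) * sqrt (w y))"
proof -
  obtain M where M: "\<And>k x y. x \<in> {0..1} \<Longrightarrow> y \<in> {0..1} \<Longrightarrow>
      \<bar>J k x * J k y / nrm k\<bar> \<le> (jacobi_scale \<alpha> w' * real (k + 1)) ^ (M * (k + 1))"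
    by (rule jacobi_product_bound) blast
  let ?a = "\<lambda>k. exp (- t * (real k * (real k + (w' + z' + 1 - real p)))) *
    (jacobi_scale \<alpha> w' * real (k + 1)) ^ (M * (k + 1))"
  have K: "K_eig p z' w' k = real k * (real k + (w' + z' + 1 - real p))" for k
    by (simp add: K_eig_def algebra_simps)
  have "summable ?a"
    by (rule summable_gaussian_superexponential) (use jacobi_scale_ge t in simp_all)
  moreover have "0 \<le> ?a k" for k using jacobi_scale_ge by simp
  moreover have "\<bar>exp (- t * K_eig p z' w' k) * jac_fun p z' w' k x * jac_fun p z' w' k y\<bar> \<le>
      ?a k * (sqrt (w x) * sqrt (w y))" if "x \<in> {0..1}" "y \<in> {0..1}" for k x y
  proof -
    have "\<bar>exp (- t * K_eig p z' w' k) * jac_fun p z' w' k x * jac_fun p z' w' k y\<bar> =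
        exp (- t * K_eig p z' w' k) * \<bar>J k x * J k y / nrm k\<bar> * (sqrt (w x) * sqrt (w y))"
      unfolding kernel_term by (simp only: abs_mult abs_exp_cancel abs_of_nonneg
          real_sqrt_ge_zero jac_weight_nonneg)
    also have "\<dots> \<le> ?a k * (sqrt (w x) * sqrt (w y))"
      unfolding K using M[OF that, of k]
      by (intro mult_right_mono mult_left_mono) (simp_all add: jac_weight_nonneg)
    finally show ?thesis .
  qed
  ultimately show ?thesis by (rule that)
qed

text \<open>Orthogonality leaves only the term \<open>k = l\<close> of the series, whose norm
  cancels the normalization. The rest of the proof justifies integrating term by term.\<close>

lemma
  assumes x: "x \<in> {0..1}"
  shows integrable_weighted_jacobi_kernel: "integrable lborel (\<lambda>y. weighted_jacobi l y * kernel x y)"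
    and integral_weighted_jacobi_kernel:
      "(\<integral>y. weighted_jacobi l y * kernel x y \<partial>lborel) = exp (- t * K_eig p z' w' l) * (J l x * sqrt (w x))"
proof -
  let ?T = "\<lambda>k y. exp (- t * K_eig p z' w' k) * jac_fun p z' w' k x * jac_fun p z' w' k y"
  let ?f = "\<lambda>k y. weighted_jacobi l y * ?T k y"
  obtain a where a: "summable a" "\<And>k. 0 \<le> a k" and T: "\<And>k y. y \<in> {0..1} \<Longrightarrow>
      \<bar>?T k y\<bar> \<le> a k * (sqrt (w x) * sqrt (w y))"
    using kernel_term_bound[of thesis] x by blast
  have "compact (J l ` {0..1})"
    by (intro compact_continuous_image continuous_on_subset[OF continuous_on_jacobi]) auto
  then obtain B where B: "\<And>y. y \<in> {0..1} \<Longrightarrow> \<bar>J l y\<bar> \<le> B"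
    unfolding real_norm_def[symmetric] by (meson bounded_iff compact_imp_bounded imageI)
  \<comment> \<open>One root of the weight at \<open>y\<close> comes from
    \<open>weighted_jacobi\<close>, the other from the kernel; together they form the integrable
    weight, and \<open>B\<close> bounds the polynomial.\<close>
  define C where "C = (\<lambda>y. sqrt (w x) * (B * (indicator {0..1} y * w y)))"
  have B0: "0 \<le> B" using B[of 0] by simp
  have f_eq: "?f k y = exp (- t * K_eig p z' w' k) * J k x / nrm k * sqrt (w x) *
      (indicator {0..1} y *\<^sub>R (J l y * J k y * w y))" for k y
  proof -
    have "sqrt (w y) * sqrt (w y) = w y" by (simp add: jac_weight_nonneg)
    then show ?thesis unfolding kernel_term weighted_jacobi_def by (simp add: mult_ac)
  qed
  have int_f: "integrable lborel (?f k)" for k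
    unfolding f_eq using set_integrable_jacobi_mult[of l k]
    by (intro Bochner_Integration.integrable_mult_right) (simp only: set_integrable_def)
  have f_le: "norm (?f k y) \<le> a k * C y" for k y
  proof (cases "y \<in> {0..1}")
    case True
    have "norm (?f k y) = \<bar>J l y\<bar> * sqrt (w y) * \<bar>?T k y\<bar>"
      using True by (simp only: weighted_jacobi_def real_norm_def abs_mult indicator_simps abs_one mult_1
          abs_of_nonneg real_sqrt_ge_zero jac_weight_nonneg)
    also have "\<dots> \<le> B * sqrt (w y) * (a k * (sqrt (w x) * sqrt (w y)))"
      using B[OF True] T[OF True, of k] B0
      by (intro mult_mono) (simp_all add: jac_weight_nonneg)
    also have "\<dots> = a k * (sqrt (w x) * (B * (sqrt (w y) * sqrt (w y))))"
      by (simp only: mult_ac)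
    also have "\<dots> = a k * C y"
      using True by (simp add: C_def jac_weight_nonneg)
    finally show ?thesis .
  next
    case False
    then show ?thesis by (simp add: weighted_jacobi_def C_def)
  qed
  have int_C: "integrable lborel C"
    unfolding C_def jac_weight_eq using integrable_jacobi_weight[OF \<alpha>_gt w']
    by (intro Bochner_Integration.integrable_mult_right) (simp add: set_integrable_def)
  have summ: "AE y in lborel. summable (\<lambda>k. norm (?f k y))"
  proof (rule AE_I2)
    fix y
    show "summable (\<lambda>k. norm (?f k y))"
      by (rule summable_comparison_test'[OF summable_mult2[OF a(1), of "C y"]])
        (use f_le in simp)
  qed
  have summ_int: "summable (\<lambda>k. \<integral>y. norm (?f k y) \<partial>lborel)"
  proof (rule summable_comparison_test'[OF summable_mult2[OF a(1), of "\<integral>y. C y \<partial>lborel"]])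
    fix k :: nat
    have "(\<integral>y. norm (?f k y) \<partial>lborel) \<le> (\<integral>y. a k * C y \<partial>lborel)"
      by (intro Bochner_Integration.integral_mono integrable_norm int_f
          Bochner_Integration.integrable_mult_right int_C f_le)
    moreover have "0 \<le> (\<integral>y. norm (?f k y) \<partial>lborel)"
      by (rule Bochner_Integration.integral_nonneg) simp
    ultimately show "norm (\<integral>y. norm (?f k y) \<partial>lborel) \<le> a k * (\<integral>y. C y \<partial>lborel)"
      by simp
  qed
  \<comment> \<open>Convergence of the kernel series is known only inside the unit interval; outside
    it \<open>weighted_jacobi\<close> annihilates both sides.\<close>
  have sum_f: "(\<Sum>k. ?f k y) = weighted_jacobi l y * kernel x y" for y
  proof (cases "y \<in> {0..1}")
    case True
    have "summable (\<lambda>k. ?T k y)"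
      by (rule summable_comparison_test'[OF summable_mult2[OF a(1),
            of "sqrt (w x) * sqrt (w y)"]])
        (use T[OF True] in simp)
    then show ?thesis unfolding kernel_def by (rule suminf_mult)
  next
    case False
    then show ?thesis by (simp add: weighted_jacobi_def)
  qed
  have "integrable lborel (\<lambda>y. \<Sum>k. ?f k y)"
    by (rule integrable_suminf[OF int_f summ summ_int])
  then show "integrable lborel (\<lambda>y. weighted_jacobi l y * kernel x y)" unfolding sum_f .
  have int_eq: "(\<integral>y. ?f k y \<partial>lborel) =
      (if k = l then exp (- t * K_eig p z' w' l) * (J l x * sqrt (w x)) else 0)" for k
  proof -
    have "(\<integral>y. ?f k y \<partial>lborel) = exp (- t * K_eig p z' w' k) * J k x / nrm k * sqrt (w x) *
        jac_inner p z' w' (J l) (J k)"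
      unfolding f_eq jac_inner_def set_lebesgue_integral_def by simp
    then show ?thesis
      using jac_inner_jacobi[of l k] nrm_pos[of l] by (cases "k = l") simp_all
  qed
  have "(\<integral>y. weighted_jacobi l y * kernel x y \<partial>lborel) = (\<Sum>k. \<integral>y. ?f k y \<partial>lborel)"
    unfolding sum_f[symmetric] by (rule integral_suminf[OF int_f summ summ_int])
  also have "\<dots> = exp (- t * K_eig p z' w' l) * (J l x * sqrt (w x))"
    unfolding int_eq by (rule sums_unique[OF sums_single, symmetric])
  finally show "(\<integral>y. weighted_jacobi l y * kernel x y \<partial>lborel) =
      exp (- t * K_eig p z' w' l) * (J l x * sqrt (w x))" .
qed

end

section \<open>The stationary density and its square root\<close>

definition vandermonde :: "(nat \<Rightarrow> real) \<Rightarrow> real" where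
  "vandermonde Y = (\<Prod>i<p. \<Prod>j<i. Y i - Y j)"

definition root_weight :: "(nat \<Rightarrow> real) \<Rightarrow> real" where
  "root_weight Y = (\<Prod>i<p. sqrt (w (Y i)))"

definition partition_fn :: real where
  "partition_fn = (LINT Y:weyl p|lborel_pow p. rho_unnorm p z' w' Y)"

lemma rho_unnorm_eq: "rho_unnorm p z' w' Y = (vandermonde Y * root_weight Y)\<^sup>2"
proof -
  have "(\<Prod>j<p. \<Prod>i<j. (Y i - Y j)\<^sup>2) = (vandermonde Y)\<^sup>2"
    unfolding vandermonde_def prod_power_distrib by (simp add: power2_commute)
  moreover have "(\<Prod>i<p. w (Y i)) = (root_weight Y)\<^sup>2"
    unfolding root_weight_def prod_power_distrib by (simp add: jac_weight_nonneg)
  ultimately show ?thesis by (simp add: rho_unnorm_def power_mult_distrib)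
qed

text \<open>The larger index stands first in each difference, so the order of the chamber fixes the
  sign and the square root of the density needs no absolute value.\<close>

lemma vandermonde_nonneg:
  assumes "Y \<in> weyl p"
  shows "0 \<le> vandermonde Y"
  unfolding vandermonde_def
proof (intro prod_nonneg)
  fix i j assume "i \<in> {..<p}" "j \<in> {..<i}"
  then have "Y j \<le> Y i"
    using assms by (simp add: weyl_def mono_on_def)
  then show "0 \<le> Y i - Y j" by simp
qed

lemma root_weight_nonneg: "0 \<le> root_weight Y"
  unfolding root_weight_def by (intro prod_nonneg) (simp add: jac_weight_nonneg)

lemma sqrt_rho_unnorm:
  assumes "Y \<in> weyl p"
  shows "sqrt (rho_unnorm p z' w' Y) = vandermonde Y * root_weight Y"
  using vandermonde_nonneg[OF assms] root_weight_nonneg[of Y] by (simp add: rho_unnorm_eq)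

lemma weyl_mem: "Y \<in> weyl p \<Longrightarrow> i < p \<Longrightarrow> Y i \<in> {0..1}"
  unfolding weyl_def using PiE_mem[of Y "{..<p}" "\<lambda>_. {0..1}" i] by simp

lemma rho_unnorm_measurable: "rho_unnorm p z' w' \<in> borel_measurable (lborel_pow p)"
proof -
  note coord = measurable_lborel_pow_component
  have "(\<lambda>X. w (X i)) \<in> borel_measurable (lborel_pow p)" if "i < p" for i
    unfolding jac_weight_eq by (rule measurable_compose[OF coord[OF that] measurable_jacobi_weight])
  then show ?thesis
    unfolding rho_unnorm_def[abs_def]
    by (intro borel_measurable_times borel_measurable_prod borel_measurable_power
        borel_measurable_diff coord) simp_all
qed

text \<open>On the cube all differences are at most 1 in modulus, which leaves the product of the
  weights. Integrability lets \<open>partition_fn_pos\<close> conclude from a zero integral that the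
  density vanishes almost everywhere.\<close>

lemma rho_unnorm_integrable: "set_integrable (lborel_pow p) (weyl p) (rho_unnorm p z' w')"
  unfolding set_integrable_def
proof (rule Bochner_Integration.integrable_bound)
  interpret product_sigma_finite "\<lambda>_::nat. lborel :: real measure" by standard
  show "integrable (lborel_pow p) (\<lambda>Y. \<Prod>i<p. indicator {0..1} (Y i) *\<^sub>R w (Y i))"
  proof (rule product_integrable_prod)
    fix i
    show "integrable lborel (\<lambda>y. indicator {0..1} y *\<^sub>R w y)"
      using integrable_jacobi_weight[OF \<alpha>_gt w'] unfolding set_integrable_def jac_weight_eq .
  qed simp
  show "(\<lambda>Y. indicator (weyl p) Y *\<^sub>R rho_unnorm p z' w' Y) \<in> borel_measurable (lborel_pow p)"
    by (intro borel_measurable_scaleR borel_measurable_indicator sets_weyl rho_unnorm_measurable)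
  show "AE Y in lborel_pow p. norm (indicator (weyl p) Y *\<^sub>R rho_unnorm p z' w' Y) \<le>
      norm (\<Prod>i<p. indicator {0..1} (Y i) *\<^sub>R w (Y i))"
  proof (rule AE_I2)
    fix Y
    show "norm (indicator (weyl p) Y *\<^sub>R rho_unnorm p z' w' Y) \<le>
        norm (\<Prod>i<p. indicator {0..1} (Y i) *\<^sub>R w (Y i))"
    proof (cases "Y \<in> weyl p")
      case True
      have "(\<Prod>i<p. indicator {0..1} (Y i) *\<^sub>R w (Y i)) = (\<Prod>i<p. w (Y i))"
        using weyl_mem[OF True] by (intro prod.cong) simp_all
      moreover have "(\<Prod>j<p. \<Prod>i<j. (Y i - Y j)\<^sup>2) \<le> 1"
      proof (intro prod_le_1 conjI prod_nonneg)
        fix i j assume "j \<in> {..<p}" "i \<in> {..<j}"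
        then have "Y i \<in> {0..1}" "Y j \<in> {0..1}" using weyl_mem[OF True] by simp_all
        then have "\<bar>Y i - Y j\<bar> \<le> 1" by (simp add: abs_le_iff)
        then show "(Y i - Y j)\<^sup>2 \<le> 1" by (simp add: abs_square_le_1)
      qed simp_all
      moreover have "0 \<le> (\<Prod>i<p. w (Y i))"
        by (intro prod_nonneg) (simp add: jac_weight_nonneg)
      moreover have "0 \<le> rho_unnorm p z' w' Y" by (simp add: rho_unnorm_eq)
      ultimately show ?thesis
        using True mult_right_mono[of "\<Prod>j<p. \<Prod>i<j. (Y i - Y j)\<^sup>2" 1 "\<Prod>i<p. w (Y i)"]
        by (simp add: rho_unnorm_def)
    qed simp
  qed
qed

section \<open>The eigenfunction of a fixed partition\<close>

context
  fixes lam :: "nat \<Rightarrow> nat"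
  assumes lam: "antimono_on {..<p} lam"
begin

definition exponent :: "nat \<Rightarrow> nat" where
  "exponent i = lam i + (p - Suc i)"

definition alternant :: "(nat \<Rightarrow> real) \<Rightarrow> real" where
  "alternant Y = Determinant.det (Matrix.mat p p (\<lambda>(i, j). J (exponent i) (Y j)))"

abbreviation (input) "F \<equiv> multi_jacobi p (z' - real p) w' lam"

text \<open>A weakly decreasing sequence plus the strictly decreasing \<open>p - Suc i\<close> is
  strictly decreasing. Distinct degrees make the Gram matrix in the norm computation
  diagonal.\<close>

lemma exponent_inj:
  assumes "i < p" "j < p" "exponent i = exponent j"
  shows "i = j"
proof -
  have less: "exponent j < exponent i" if "i < j" "j < p" for i j
  proof -
    have "lam j \<le> lam i" using lam that by (auto simp: monotone_on_def)
    then show ?thesis using that by (simp add: exponent_def)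
  qed
  show ?thesis using less[of i j] less[of j i] assms by (cases i j rule: linorder_cases) simp_all
qed

text \<open>On the diagonals both sides are zero, whatever value the limit has, so later
  cancellations need no exceptional set.\<close>

lemma multi_jacobi_mult_vandermonde: "F Y * vandermonde Y = alternant Y"
proof (cases "inj_on Y {..<p}")
  case True
  then have "vandermonde Y \<noteq> 0" unfolding vandermonde_def using vandermonde_nonzero_iff by blast
  moreover have "F Y = alternant Y / vandermonde Y"
    unfolding alternant_def vandermonde_def exponent_def
    by (rule multi_jacobi_eq_quotient[OF jacobi_eq_pcompose True])
  ultimately show ?thesis by simp
next
  case False
  then have "vandermonde Y = 0" unfolding vandermonde_def using vandermonde_nonzero_iff by blast
  moreover have "alternant Y = 0"
    unfolding alternant_def using False by (rule det_mat_eq_0_if_not_inj)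
  ultimately show ?thesis by simp
qed

lemma det_weighted_jacobi:
  assumes "Y \<in> weyl p"
  shows "Determinant.det (Matrix.mat p p (\<lambda>(i, j). weighted_jacobi (exponent i) (Y j))) =
    root_weight Y * alternant Y"
proof -
  have "Matrix.mat p p (\<lambda>(i, j). weighted_jacobi (exponent i) (Y j)) =
      Matrix.mat p p (\<lambda>(i, j). 1 * J (exponent i) (Y j) * sqrt (w (Y j)))"
    by (rule eq_matI) (use weyl_mem[OF assms] in \<open>simp_all add: weighted_jacobi_def\<close>)
  then show ?thesis
    unfolding alternant_def root_weight_def by (simp only: det_mat_scale) simp
qed

lemma multi_jacobi_sq_rho_unnorm:
  assumes "Y \<in> weyl p"
  shows "(F Y)\<^sup>2 * rho_unnorm p z' w' Y =
    Determinant.det (Matrix.mat p p (\<lambda>(i, j). weighted_jacobi (exponent i) (Y j))) *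
    Determinant.det (Matrix.mat p p (\<lambda>(i, j). weighted_jacobi (exponent i) (Y j)))"
  unfolding det_weighted_jacobi[OF assms] multi_jacobi_mult_vandermonde[symmetric] rho_unnorm_eq
  by (simp add: power2_eq_square mult_ac)

lemma
  shows multi_jacobi_norm_integrable:
      "set_integrable (lborel_pow p) (weyl p) (\<lambda>Y. (F Y)\<^sup>2 * rho_unnorm p z' w' Y)" (is ?int)
    and multi_jacobi_norm:
      "(LINT Y:weyl p|lborel_pow p. (F Y)\<^sup>2 * rho_unnorm p z' w' Y) =
        (\<Prod>i<p. jac_inner p z' w' (J (exponent i)) (J (exponent i)))" (is ?eq)
proof -
  let ?G = "\<lambda>Y. Determinant.det (Matrix.mat p p (\<lambda>(i, j). weighted_jacobi (exponent i) (Y j))) *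
    Determinant.det (Matrix.mat p p (\<lambda>(i, j). weighted_jacobi (exponent i) (Y j)))"
  have supp: "weighted_jacobi k y = 0" if "y \<notin> {0..1}" for k y
    using that by (simp add: weighted_jacobi_def)
  have int: "set_integrable (lborel_pow p) (weyl p) ?G"
    by (rule andreief_weyl(1)) (rule integrable_weighted_jacobi_mult, rule supp)
  have "(LINT Y:weyl p|lborel_pow p. ?G Y) = Determinant.det
      (Matrix.mat p p (\<lambda>(i, j). \<integral>y. weighted_jacobi (exponent i) y * weighted_jacobi (exponent j) y \<partial>lborel))"
    by (rule andreief_weyl(2)) (rule integrable_weighted_jacobi_mult, rule supp)
  also have "Matrix.mat p p (\<lambda>(i, j). \<integral>y. weighted_jacobi (exponent i) y * weighted_jacobi (exponent j) y \<partial>lborel) =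
      Matrix.mat p p (\<lambda>(i, j). if i = j then nrm (exponent i) else 0)"
    by (rule eq_matI) (use exponent_inj in \<open>auto simp: integral_weighted_jacobi_mult\<close>)
  finally have eq: "(LINT Y:weyl p|lborel_pow p. ?G Y) = (\<Prod>i<p. nrm (exponent i))"
    by (simp only: det_mat_diagonal)
  have ind: "indicator (weyl p) Y *\<^sub>R ((F Y)\<^sup>2 * rho_unnorm p z' w' Y) =
      indicator (weyl p) Y *\<^sub>R ?G Y" for Y
    by (cases "Y \<in> weyl p") (simp_all add: multi_jacobi_sq_rho_unnorm)
  show ?int
    using int unfolding set_integrable_def ind .
  show ?eq
    using eq unfolding set_lebesgue_integral_def ind .
qed

lemma multi_jacobi_norm_pos:
  "0 < (LINT Y:weyl p|lborel_pow p. (F Y)\<^sup>2 * rho_unnorm p z' w' Y)"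
  unfolding multi_jacobi_norm by (intro prod_pos) (simp add: nrm_pos)

text \<open>Used twice: for the nonvanishing of the eigenfunction and for the positivity of the
  normalization integral.\<close>

lemma not_AE_weyl_multi_jacobi_zero:
  "\<not> (AE Y in lborel_pow p. Y \<in> weyl p \<longrightarrow> (F Y)\<^sup>2 * rho_unnorm p z' w' Y = 0)"
proof
  assume "AE Y in lborel_pow p. Y \<in> weyl p \<longrightarrow> (F Y)\<^sup>2 * rho_unnorm p z' w' Y = 0"
  then have "AE Y in lborel_pow p.
      indicator (weyl p) Y *\<^sub>R ((F Y)\<^sup>2 * rho_unnorm p z' w' Y) = 0"
    by (rule AE_mp) (rule AE_I2, simp add: indicator_def)
  then have "(LINT Y:weyl p|lborel_pow p. (F Y)\<^sup>2 * rho_unnorm p z' w' Y) = 0"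
    unfolding set_lebesgue_integral_def by (rule integral_eq_zero_AE)
  then show False using multi_jacobi_norm_pos by simp
qed

text \<open>Were the integral zero, the nonnegative density would vanish almost everywhere on the
  chamber, and with it the integrand of the positive squared norm.\<close>

lemma partition_fn_pos: "0 < partition_fn"
proof -
  let ?R = "\<lambda>Y. indicator (weyl p) Y *\<^sub>R rho_unnorm p z' w' Y"
  have nonneg: "AE Y in lborel_pow p. 0 \<le> ?R Y"
    by (rule AE_I2) (simp add: rho_unnorm_eq)
  have Z: "partition_fn = (\<integral>Y. ?R Y \<partial>lborel_pow p)"
    by (simp only: partition_fn_def set_lebesgue_integral_def)
  have "partition_fn \<noteq> 0"
  proof
    assume "partition_fn = 0"
    then have "AE Y in lborel_pow p. ?R Y = 0"
      using integral_nonneg_eq_0_iff_AE[OF rho_unnorm_integrable[unfolded set_integrable_def] nonneg]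
      by (simp only: Z)
    then have "AE Y in lborel_pow p. Y \<in> weyl p \<longrightarrow> (F Y)\<^sup>2 * rho_unnorm p z' w' Y = 0"
      by (rule AE_mp) (rule AE_I2, simp add: indicator_def)
    then show False using not_AE_weyl_multi_jacobi_zero by contradiction
  qed
  moreover have "0 \<le> partition_fn"
    unfolding Z by (rule integral_nonneg_AE[OF nonneg])
  ultimately show ?thesis by simp
qed

lemma rho_eq: "rho p z' w' Y = rho_unnorm p z' w' Y / partition_fn"
  by (simp add: rho_def partition_fn_def)

lemma rho_nonneg: "0 \<le> rho p z' w' Y"
  using partition_fn_pos by (simp add: rho_eq rho_unnorm_eq)

lemma rho_measurable: "rho p z' w' \<in> borel_measurable (lborel_pow p)"
  unfolding rho_eq[abs_def] using rho_unnorm_measurable by simp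

lemma weyl_space: "weyl p \<inter> space (lborel_pow p) \<in> sets (lborel_pow p)"
  using sets_weyl by simp

lemma F_measurable: "F \<in> borel_measurable (lborel_pow p)"
  by (rule measurable_multi_jacobi[OF jacobi_eq_pcompose])

text \<open>Makes explicit that zeros of the density may be ignored, which are the starting points
  where \<open>trans_dens\<close> divides by zero.\<close>

lemma AE_mu_iff:
  "(AE X in mu p z' w'. P X) \<longleftrightarrow> (AE X in lborel_pow p. X \<in> weyl p \<longrightarrow> 0 < rho p z' w' X \<longrightarrow> P X)"
proof -
  have "(\<lambda>X. ennreal (rho p z' w' X)) \<in> borel_measurable (restrict_space (lborel_pow p) (weyl p))"
    by (intro measurable_restrict_space1 measurable_compose[OF rho_measurable measurable_ennreal])
  then show ?thesis
    unfolding mu_def by (simp add: AE_density AE_restrict_space_iff[OF weyl_space])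
qed

lemma multi_jacobi_L2: "F \<in> L2_space (mu p z' w')"
proof -
  let ?M = "restrict_space (lborel_pow p) (weyl p)"
  have F: "F \<in> borel_measurable ?M" by (rule measurable_restrict_space1[OF F_measurable])
  have rho: "rho p z' w' \<in> borel_measurable ?M"
    by (rule measurable_restrict_space1[OF rho_measurable])
  have "integrable ?M (\<lambda>Y. rho p z' w' Y *\<^sub>R (F Y)\<^sup>2)"
  proof -
    have "set_integrable (lborel_pow p) (weyl p)
        (\<lambda>Y. ((F Y)\<^sup>2 * rho_unnorm p z' w' Y) / partition_fn)"
      using multi_jacobi_norm_integrable by simp
    then show ?thesis
      unfolding set_integrable_def
      by (subst integrable_restrict_space[OF weyl_space]) (simp add: rho_eq mult.commute)
  qed
  then have "integrable (density ?M (\<lambda>Y. ennreal (rho p z' w' Y))) (\<lambda>Y. (F Y)\<^sup>2)"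
    by (subst integrable_density) (use F rho rho_nonneg in simp_all)
  then show ?thesis
    using F by (simp add: L2_space_def mu_def)
qed

lemma multi_jacobi_not_AE_zero: "\<not> (AE X in mu p z' w'. F X = 0)"
proof
  assume "AE X in mu p z' w'. F X = 0"
  then have "AE X in lborel_pow p. X \<in> weyl p \<longrightarrow> 0 < rho p z' w' X \<longrightarrow> F X = 0"
    unfolding AE_mu_iff .
  then have "AE X in lborel_pow p. X \<in> weyl p \<longrightarrow> (F X)\<^sup>2 * rho_unnorm p z' w' X = 0"
  proof (rule AE_mp, intro AE_I2 impI)
    fix X assume X: "X \<in> weyl p" and "X \<in> weyl p \<longrightarrow> 0 < rho p z' w' X \<longrightarrow> F X = 0"
    then have "F X = 0 \<or> rho p z' w' X = 0" using rho_nonneg[of X] by linarith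
    then show "(F X)\<^sup>2 * rho_unnorm p z' w' X = 0"
      using partition_fn_pos by (simp add: rho_eq)
  qed
  then show False using not_AE_weyl_multi_jacobi_zero by contradiction
qed

lemma markov_sg_multi_jacobi:
  assumes t: "t > 0" and X: "X \<in> weyl p" and pos: "0 < rho p z' w' X"
  shows "markov_sg p z' w' t F X =
    exp (t * (\<Sum>i<p. K_eig p z' w' (p - Suc i) - K_eig p z' w' (lam i + (p - Suc i)))) * F X"
proof -
  let ?D = "\<lambda>Y. Determinant.det (Matrix.mat p p (\<lambda>(i, j). kernel t (X i) (Y j)))"
  let ?G = "\<lambda>Y. Determinant.det (Matrix.mat p p (\<lambda>(i, j). weighted_jacobi (exponent i) (Y j))) * ?D Y"
  let ?e = "\<lambda>i. exp (- t * K_eig p z' w' (exponent i))"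
  let ?s = "sqrt partition_fn"
  \<comment> \<open>What depends on \<open>X\<close> alone. The normalization integral cancels in
    the quotient of the square roots of the densities.\<close>
  define c where "c = exp (t * K_sum p z' w') / (vandermonde X * root_weight X)"
  have s: "0 < ?s" using partition_fn_pos by simp
  have sqrt_rho: "sqrt (rho p z' w' Y) = vandermonde Y * root_weight Y / ?s" if "Y \<in> weyl p" for Y
    by (simp add: rho_eq real_sqrt_divide sqrt_rho_unnorm[OF that])
  have "rho_unnorm p z' w' X \<noteq> 0" using pos by (auto simp: rho_eq)
  then have nz: "vandermonde X \<noteq> 0" "root_weight X \<noteq> 0" by (auto simp: rho_unnorm_eq)
  have integrand: "F Y * trans_dens p z' w' t Y X = c * ?G Y" if Y: "Y \<in> weyl p" for Y
  proof -
    have "F Y * trans_dens p z' w' t Y X =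
        (F Y * vandermonde Y * root_weight Y) * (exp (t * K_sum p z' w') / (vandermonde X * root_weight X)) * ?D Y"
      using s unfolding trans_dens_def sqrt_rho[OF Y] sqrt_rho[OF X] kernel_def[OF t]
      by (simp add: field_simps)
    then show ?thesis
      unfolding multi_jacobi_mult_vandermonde det_weighted_jacobi[OF Y] c_def by (simp only: mult_ac)
  qed
  have "markov_sg p z' w' t F X = (LINT Y:weyl p|lborel_pow p. c * ?G Y)"
    unfolding markov_sg_def set_lebesgue_integral_def
  proof (rule Bochner_Integration.integral_cong[OF refl])
    fix Y
    show "indicator (weyl p) Y *\<^sub>R (F Y * trans_dens p z' w' t Y X) =
        indicator (weyl p) Y *\<^sub>R (c * ?G Y)"
      using integrand[of Y] by (cases "Y \<in> weyl p") simp_all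
  qed
  also have "\<dots> = c * (LINT Y:weyl p|lborel_pow p. ?G Y)"
    by simp
  \<comment> \<open>The second family in the identity consists of the kernel sections at the
    coordinates of \<open>X\<close>, which thus index the columns of the result.\<close>
  also have "(LINT Y:weyl p|lborel_pow p. ?G Y) = Determinant.det
      (Matrix.mat p p (\<lambda>(i, j). \<integral>y. weighted_jacobi (exponent i) y * kernel t (X j) y \<partial>lborel))"
  proof (rule andreief_weyl(2))
    fix i k assume "i < p" "k < p"
    then show "integrable lborel (\<lambda>y. weighted_jacobi (exponent i) y * kernel t (X k) y)"
      using weyl_mem[OF X] by (intro integrable_weighted_jacobi_kernel t)
  qed (simp add: weighted_jacobi_def)
  also have "Matrix.mat p p (\<lambda>(i, j). \<integral>y. weighted_jacobi (exponent i) y * kernel t (X j) y \<partial>lborel) =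
      Matrix.mat p p (\<lambda>(i, j). ?e i * J (exponent i) (X j) * sqrt (w (X j)))"
    by (rule eq_matI) (simp_all add: integral_weighted_jacobi_kernel[OF t weyl_mem[OF X]])
  \<comment> \<open>The eigenvalues scale the rows and the roots of the weights scale the columns;
    what remains is the alternant at \<open>X\<close>.\<close>
  also have "Determinant.det \<dots> = (\<Prod>i<p. ?e i) * root_weight X * (F X * vandermonde X)"
    unfolding det_mat_scale multi_jacobi_mult_vandermonde alternant_def root_weight_def ..
  also have "c * ((\<Prod>i<p. ?e i) * root_weight X * (F X * vandermonde X)) =
      exp (t * K_sum p z' w') * (\<Prod>i<p. ?e i) * F X"
    using nz by (simp add: c_def)
  also have "exp (t * K_sum p z' w') * (\<Prod>i<p. ?e i) =
      exp (t * (\<Sum>i<p. K_eig p z' w' (p - Suc i) - K_eig p z' w' (lam i + (p - Suc i))))"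
  proof -
    \<comment> \<open>Reversing the order of summation shows \<open>K_sum\<close> as the sum over
      the exponents of the empty partition, so its factor normalizes the eigenvalue of that
      partition to 1.\<close>
    have "K_sum p z' w' = (\<Sum>i<p. K_eig p z' w' (p - Suc i))"
      unfolding K_sum_def by (rule sum.nat_diff_reindex[symmetric])
    moreover have "(\<Prod>i<p. ?e i) = exp (- t * (\<Sum>i<p. K_eig p z' w' (exponent i)))"
      by (simp add: exp_sum[symmetric] sum_distrib_left)
    ultimately show ?thesis
      by (simp add: exp_add[symmetric] exponent_def sum_subtractf right_diff_distrib)
  qed
  finally show ?thesis .
qed

end

end

theorem theorem6p1:
  fixes p :: nat and z' w' t :: real and lam :: "nat \<Rightarrow> nat"
  assumes "z' > real p - 1" and "w' > -1" and "t > 0"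
    and "antimono_on {..<p} lam"
  shows "L2_eigenfunction (mu p z' w') (markov_sg p z' w' t)
           (exp (t * (\<Sum>i<p. K_eig p z' w' (p - Suc i) - K_eig p z' w' (lam i + (p - Suc i)))))
           (multi_jacobi p (z' - real p) w' lam)"
proof -
  interpret jacobi_parameters p z' w'
    using assms(1,2) by unfold_locales
  have "AE X in mu p z' w'. markov_sg p z' w' t (multi_jacobi p (z' - real p) w' lam) X =
      exp (t * (\<Sum>i<p. K_eig p z' w' (p - Suc i) - K_eig p z' w' (lam i + (p - Suc i)))) *
      multi_jacobi p (z' - real p) w' lam X"
    unfolding AE_mu_iff[OF assms(4)]
    by (intro AE_I2 impI markov_sg_multi_jacobi[OF assms(4,3)])
  then show ?thesis
    unfolding L2_eigenfunction_def
    using multi_jacobi_L2[OF assms(4)] multi_jacobi_not_AE_zero[OF assms(4)] by blast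
qed

end
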